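(* Let $\mathcal{G}=(\Gamma,G)$ be a locally finite nonsingular graph of countable groups with $\Gamma^1\neq\emptyset$, and let $v\in\Gamma^0$. The action of $\pi_1(\mathcal{G},v)$ on $v\partial X_{\mathcal{G}}$ is locally contractive if for every edge $e\in\Gamma^1$ there is a repeatable $\mathcal{G}$-path $\eta$ with an entrance, such that $\eta$ contains an edge that can flow to $e$.
   Context: Graphs. A graph $\Gamma=(\Gamma^0,\Gamma^1,r,s)$ consists of countable sets $\Gamma^0$ (vertices) and $\Gamma^1$ (edges), maps $r,s:\Gamma^1\to\Gamma^0$ (range, source), and a map $e\mapsto\overline e$ on $\Gamma^1$ with $\overline e\neq e$, $\overline{\overline e}=e$, $s(e)=r(\overline e)$. Graphs of groups. A graph of groups $\mathcal{G}=(\Gamma,G)$ consists of a connected graph $\Gamma$, groups $G_x$ ($x\in\Gamma^0$) and $G_e=G_{\overline e}$ ($e\in\Gamma^1$), and monomorphisms $\alpha_e:G_e\to G_{r(e)}$. It is locally finite if $|r^{-1}(x)|<\infty$ for all $x$ and $[G_{r(e)}:\alpha_e(G_e)]<\infty$ for all $e$; nonsingular if $[G_{r(e)}:\alpha_e(G_e)]>1$ whenever $r^{-1}(r(e))=\{e\}$; a graph of countable groups if every $G_x$ is countable. For each $e$ fix a transversal $\Sigma_e\ni1$ for $G_{r(e)}/\alpha_e(G_e)$. Words. A $\mathcal{G}$-word is a sequence $g_1$, or $g_1e_1\cdots g_ne_n$, or $g_1e_1\cdots g_ne_ng_{n+1}$ with $s(e_i)=r(e_{i+1})$, $g_j\in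 G_{r(e_j)}$, $g_{n+1}\in G_{s(e_n)}$ (and $g_1$ in some vertex group if $n=0$); range $r(e_1)$, source $s(e_n)$, length $n$. It is reduced if (for $n>0$) $g_j\in\Sigma_{e_j}$ for $1\le j\le n$ and $g_{i+1}\ne1$ whenever $e_i=\overline{e_{i+1}}$ ($g_{n+1}$ arbitrary). A $\mathcal{G}$-path is a reduced $\mathcal{G}$-word $1_x$ or $g_1e_1\cdots g_ne_n$. $\pi_1(\mathcal{G},v)$ is the group of $\mathcal{G}$-words with range and source $v$ modulo the relations of the vertex groups and the relations $e\overline e=1_{r(e)}$, $e\,\alpha_{\overline e}(g)=\alpha_e(g)\,e$ ($g\in G_e$), under concatenation; each class contains a unique reduced $\mathcal{G}$-word. Boundary. An infinite reduced $\mathcal{G}$-path is a sequence $g_1e_1g_2e_2\cdots$ all of whose initial segments $g_1e_1\cdots g_ne_n$ are $\mathcal{G}$-paths. $v\partial X_{\mathcal{G}}$ is the set of those with range $r(e_1)=v$. For a $\mathcal{G}$-path $\mu$, $Z(\mu)$ is the set of infinite reduced $\mathcal{G}$-paths extending $\mu$; these sets (with $r(\mu)=v$) are a base for the topology of $v\partial X_{\mathcal{G}}$. $\pi_1(\mathcal{G},v)$ acts on $v\partial X_{\mathcal{G}}$ by concatenation followed by reduction. An action of a discrete group $\Lambda$ on a locally compact Hausdorff space $Y$ is locally contractive if for every nonempty open $U\subseteq Y$ there are an open set $V\subseteq U$ and $\lambda\in\Lambda$ with $\lambda\overline V\subsetneq V$. An edge $f$ can flow to an edge $e$ if there is an infinite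 reduced $\mathcal{G}$-path $\xi=h_1f_1h_2f_2\cdots\in Z(1e)$ (so $h_1f_1=1e$) with $f=f_i$ for some $i\ge2$. A $\mathcal{G}$-path $g_1e_1\cdots g_ne_n$ ($n\ge1$) is repeatable if $r(e_1)=s(e_n)$ and $g_1e_1\ne1\overline{e_n}$. Such a path $\eta=g_1f_1\cdots g_mf_m$ has an entrance at $s(f_i)$ if $\sum_{r(f)=s(f_i)}|\Sigma_f|\ge3$; it has an entrance if it has one at $s(f_i)$ for some $i$. *)

theory Defs
  imports
    "HOL-Algebra.Left_Coset"
    "HOL-Analysis.Abstract_Topology"
    "HOL-Library.Extended_Nat"
    "HOL-Library.Countable_Set"
    "Graph_Theory.Bidirected_Digraph"
    "Graph_Theory.Digraph_Component"
begin

definition index :: "('a, 'b) monoid_scheme \<Rightarrow> 'a set \<Rightarrow> enat" where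
  "index G H =
     (if finite (lcosets\<^bsub>G\<^esub> H) then enat (card (lcosets\<^bsub>G\<^esub> H)) else \<infinity>)"

definition is_transversal :: "('a, 'b) monoid_scheme \<Rightarrow> 'a set \<Rightarrow> 'a set \<Rightarrow> bool" where
  "is_transversal G H T \<longleftrightarrow>
     T \<subseteq> carrier G \<and> (\<forall>C \<in> lcosets\<^bsub>G\<^esub> H. \<exists>!t. t \<in> T \<and> t \<in> C)"

definition locally_contractive ::
    "('a, 'b) monoid_scheme \<Rightarrow> 'y topology \<Rightarrow> ('a \<Rightarrow> 'y \<Rightarrow> 'y) \<Rightarrow> bool" where
  "locally_contractive \<Lambda> Y act \<longleftrightarrow>
     (\<forall>U. openin Y U \<and> U \<noteq> {} \<longrightarrow>
        (\<exists>V \<gamma>. openin Y V \<and> V \<subseteq> U \<and> \<gamma> \<in> carrier \<Lambda> \<and> act \<gamma> ` (Y closure_of V) \<subset> V))"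

text \<open>
  Graphs in the sense of Serre: the range and source maps are \<^const>\<open>head\<close> and \<^const>\<open>tail\<close>, and
  the edge reversal is \<open>bar\<close>, which \<^locale>\<open>bidirected_digraph\<close> normalises to be the identity
  off the set of edges.
\<close>

locale graph_of_groups = bidirected_digraph \<Gamma> bar
  for \<Gamma> :: "('v, 'e) pre_digraph" and bar :: "'e \<Rightarrow> 'e" +
  fixes GV :: "'v \<Rightarrow> 'g monoid"
    and GE :: "'e \<Rightarrow> 'h monoid"
    and \<alpha> :: "'e \<Rightarrow> 'h \<Rightarrow> 'g"
  assumes countable_verts: "countable (verts \<Gamma>)"
    and countable_arcs: "countable (arcs \<Gamma>)"
    and connected: "Digraph_Component.connected \<Gamma>"
    and group_GV: "x \<in> verts \<Gamma> \<Longrightarrow> group (GV x)"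
    and group_GE: "e \<in> arcs \<Gamma> \<Longrightarrow> group (GE e)"
    and GE_bar: "e \<in> arcs \<Gamma> \<Longrightarrow> GE (bar e) = GE e"
    and \<alpha>_mon: "e \<in> arcs \<Gamma> \<Longrightarrow> \<alpha> e \<in> mon (GE e) (GV (head \<Gamma> e))"
begin

definition locally_finite :: bool where
  "locally_finite \<longleftrightarrow>
     (\<forall>x \<in> verts \<Gamma>. finite (in_arcs \<Gamma> x)) \<and>
     (\<forall>e \<in> arcs \<Gamma>. index (GV (head \<Gamma> e)) (\<alpha> e ` carrier (GE e)) < \<infinity>)"

definition nonsingular :: bool where
  "nonsingular \<longleftrightarrow>
     (\<forall>e \<in> arcs \<Gamma>. in_arcs \<Gamma> (head \<Gamma> e) = {e} \<longrightarrow>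
        index (GV (head \<Gamma> e)) (\<alpha> e ` carrier (GE e)) > 1)"

definition countable_groups :: bool where
  "countable_groups \<longleftrightarrow> (\<forall>x \<in> verts \<Gamma>. countable (carrier (GV x)))"

end

text \<open>
  The triple \<open>(x, [(g\<^sub>1, e\<^sub>1), \<dots>, (g\<^sub>n, e\<^sub>n)], g)\<close> encodes the word
  \<open>g\<^sub>1 e\<^sub>1 \<dots> g\<^sub>n e\<^sub>n g\<close> with range \<open>x\<close>.  A word without a final group element is identified
  with the one whose final group element is trivial; this is what makes reduced representatives
  unique.
\<close>

type_synonym ('v, 'g, 'e) gword = "'v \<times> ('g \<times> 'e) list \<times> 'g"

locale graph_of_groups_transversals = graph_of_groups \<Gamma> bar GV GE \<alpha>
  for \<Gamma> :: "('v, 'e) pre_digraph" and bar :: "'e \<Rightarrow> 'e"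
    and GV :: "'v \<Rightarrow> 'g monoid" and GE :: "'e \<Rightarrow> 'h monoid" and \<alpha> :: "'e \<Rightarrow> 'h \<Rightarrow> 'g" +
  fixes \<Sigma> :: "'e \<Rightarrow> 'g set"
  assumes transversal:
      "e \<in> arcs \<Gamma> \<Longrightarrow> is_transversal (GV (head \<Gamma> e)) (\<alpha> e ` carrier (GE e)) (\<Sigma> e)"
    and one_in_transversal: "e \<in> arcs \<Gamma> \<Longrightarrow> \<one>\<^bsub>GV (head \<Gamma> e)\<^esub> \<in> \<Sigma> e"
begin

fun is_word :: "('v, 'g, 'e) gword \<Rightarrow> bool" where
  "is_word (x, [], g) \<longleftrightarrow> x \<in> verts \<Gamma> \<and> g \<in> carrier (GV x)"
| "is_word (x, (h, e) # p, g) \<longleftrightarrow>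
     e \<in> arcs \<Gamma> \<and> head \<Gamma> e = x \<and> h \<in> carrier (GV x) \<and> is_word (tail \<Gamma> e, p, g)"

fun rng :: "('v, 'g, 'e) gword \<Rightarrow> 'v" where
  "rng (x, p, g) = x"

fun src :: "('v, 'g, 'e) gword \<Rightarrow> 'v" where
  "src (x, p, g) = (if p = [] then x else tail \<Gamma> (snd (last p)))"

text \<open>Concatenation multiplies the two adjacent elements of the vertex group where the words meet.\<close>

fun wconcat :: "('v, 'g, 'e) gword \<Rightarrow> ('v, 'g, 'e) gword \<Rightarrow> ('v, 'g, 'e) gword" where
  "wconcat (x, p, g) (y, [], h) = (x, p, g \<otimes>\<^bsub>GV y\<^esub> h)"
| "wconcat (x, p, g) (y, (h, e) # q, k) = (x, p @ (g \<otimes>\<^bsub>GV y\<^esub> h, e) # q, k)"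

definition vertex_word :: "'v \<Rightarrow> 'g \<Rightarrow> ('v, 'g, 'e) gword" where
  "vertex_word x g = (x, [], g)"

definition edge_word :: "'e \<Rightarrow> ('v, 'g, 'e) gword" where
  "edge_word e = (head \<Gamma> e, [(\<one>\<^bsub>GV (head \<Gamma> e)\<^esub>, e)], \<one>\<^bsub>GV (tail \<Gamma> e)\<^esub>)"

text \<open>
  The congruence generated by the edge relations.  The relations of the vertex groups hold already
  on the level of words.
\<close>

inductive word_eq :: "('v, 'g, 'e) gword \<Rightarrow> ('v, 'g, 'e) gword \<Rightarrow> bool" (infix \<open>\<sim>\<close> 50) where
  refl: "is_word w \<Longrightarrow> w \<sim> w"
| sym: "w \<sim> w' \<Longrightarrow> w' \<sim> w"
| trans: "w \<sim> w' \<Longrightarrow> w' \<sim> w'' \<Longrightarrow> w \<sim> w''"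
| concat: "w \<sim> w' \<Longrightarrow> u \<sim> u' \<Longrightarrow> src w = rng u \<Longrightarrow> wconcat w u \<sim> wconcat w' u'"
| cancel: "e \<in> arcs \<Gamma> \<Longrightarrow>
    wconcat (edge_word e) (edge_word (bar e)) \<sim> vertex_word (head \<Gamma> e) \<one>\<^bsub>GV (head \<Gamma> e)\<^esub>"
| slide: "e \<in> arcs \<Gamma> \<Longrightarrow> g \<in> carrier (GE e) \<Longrightarrow>
    wconcat (edge_word e) (vertex_word (tail \<Gamma> e) (\<alpha> (bar e) g)) \<sim>
    wconcat (vertex_word (head \<Gamma> e) (\<alpha> e g)) (edge_word e)"

definition pi1 :: "'v \<Rightarrow> ('v, 'g, 'e) gword set monoid" where
  "pi1 v = \<lparr>
     carrier = {{w. u \<sim> w} | u. is_word u \<and> rng u = v \<and> src u = v},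
     monoid.mult = (\<lambda>A B. {w. \<exists>a \<in> A. \<exists>b \<in> B. wconcat a b \<sim> w}),
     one = {w. vertex_word v \<one>\<^bsub>GV v\<^esub> \<sim> w}\<rparr>"

fun reduced :: "('v, 'g, 'e) gword \<Rightarrow> bool" where
  "reduced (x, p, g) \<longleftrightarrow>
     is_word (x, p, g) \<and>
     (\<forall>i < length p. fst (p ! i) \<in> \<Sigma> (snd (p ! i))) \<and>
     (\<forall>i. Suc i < length p \<and> snd (p ! i) = bar (snd (p ! Suc i)) \<longrightarrow>
        fst (p ! Suc i) \<noteq> \<one>\<^bsub>GV (head \<Gamma> (snd (p ! Suc i)))\<^esub>)"

definition reduction :: "('v, 'g, 'e) gword \<Rightarrow> ('v, 'g, 'e) gword" where
  "reduction w = (THE u. reduced u \<and> w \<sim> u)"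

definition is_path :: "('v, 'g, 'e) gword \<Rightarrow> bool" where
  "is_path w \<longleftrightarrow> reduced w \<and> snd (snd w) = \<one>\<^bsub>GV (src w)\<^esub>"

text \<open>Infinite paths \<open>g\<^sub>1 e\<^sub>1 g\<^sub>2 e\<^sub>2 \<dots>\<close> are sequences indexed from 0.\<close>

definition segment :: "(nat \<Rightarrow> 'g \<times> 'e) \<Rightarrow> nat \<Rightarrow> ('v, 'g, 'e) gword" where
  "segment \<xi> n =
     (let x = head \<Gamma> (snd (\<xi> 0)); p = map \<xi> [0..<n]
      in (x, p, \<one>\<^bsub>GV (if n = 0 then x else tail \<Gamma> (snd (\<xi> (n - 1))))\<^esub>))"

definition infinite_path :: "(nat \<Rightarrow> 'g \<times> 'e) \<Rightarrow> bool" where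
  "infinite_path \<xi> \<longleftrightarrow> (\<forall>n. is_path (segment \<xi> n))"

definition boundary :: "'v \<Rightarrow> (nat \<Rightarrow> 'g \<times> 'e) set" where
  "boundary v = {\<xi>. infinite_path \<xi> \<and> head \<Gamma> (snd (\<xi> 0)) = v}"

definition Z :: "('v, 'g, 'e) gword \<Rightarrow> (nat \<Rightarrow> 'g \<times> 'e) set" where
  "Z \<mu> = {\<xi>. infinite_path \<xi> \<and> (\<exists>n. segment \<xi> n = \<mu>)}"

text \<open>
  Any two sets \<open>Z \<mu>\<close> are nested or disjoint, so they form a base, not just a subbase, of the
  topology they generate.
\<close>

definition boundary_topology :: "'v \<Rightarrow> (nat \<Rightarrow> 'g \<times> 'e) topology" where
  "boundary_topology v = topology_generated_by {Z \<mu> | \<mu>. is_path \<mu> \<and> rng \<mu> = v}"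

text \<open>
  Reducing the infinite word obtained by concatenating \<open>w\<close> and \<open>\<xi>\<close> may change infinitely many of
  its letters, but each initial segment of the result is determined by finitely many letters of
  \<open>\<xi>\<close>.  Thus the result is the infinite path whose initial segments are, eventually,
  initial segments of the reductions of \<open>w\<close> followed by \<open>g\<^sub>1 e\<^sub>1 \<dots> g\<^sub>n e\<^sub>n\<close>.
\<close>

definition concat_reduce ::
    "('v, 'g, 'e) gword \<Rightarrow> (nat \<Rightarrow> 'g \<times> 'e) \<Rightarrow> (nat \<Rightarrow> 'g \<times> 'e)" where
  "concat_reduce w \<xi> = (THE \<eta>. \<eta> \<in> boundary (rng w) \<and>
     (\<forall>k. \<forall>\<^sub>F n in sequentially. \<exists>q h.
        reduction (wconcat w (segment \<xi> n)) = (rng w, map \<eta> [0..<k] @ q, h)))"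

definition action ::
    "('v, 'g, 'e) gword set \<Rightarrow> (nat \<Rightarrow> 'g \<times> 'e) \<Rightarrow> (nat \<Rightarrow> 'g \<times> 'e)" where
  "action \<gamma> \<xi> = concat_reduce (THE w. w \<in> \<gamma> \<and> reduced w) \<xi>"

definition can_flow_to :: "'e \<Rightarrow> 'e \<Rightarrow> bool" where
  "can_flow_to f e \<longleftrightarrow> (\<exists>\<xi> \<in> Z (edge_word e). \<exists>i \<ge> 1. snd (\<xi> i) = f)"

fun repeatable :: "('v, 'g, 'e) gword \<Rightarrow> bool" where
  "repeatable (x, p, g) \<longleftrightarrow>
     is_path (x, p, g) \<and> p \<noteq> [] \<and> src (x, p, g) = x \<and>
     hd p \<noteq> (\<one>\<^bsub>GV x\<^esub>, bar (snd (last p)))"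

fun edges :: "('v, 'g, 'e) gword \<Rightarrow> 'e set" where
  "edges (x, p, g) = snd ` set p"

text \<open>The sum is over a finite set of finite cardinalities when the graph of groups is locally finite.\<close>

definition entrance_at :: "'v \<Rightarrow> bool" where
  "entrance_at x \<longleftrightarrow> (\<Sum>f \<in> in_arcs \<Gamma> x. card (\<Sigma> f)) \<ge> 3"

definition has_entrance :: "('v, 'g, 'e) gword \<Rightarrow> bool" where
  "has_entrance \<eta> \<longleftrightarrow> (\<exists>f \<in> edges \<eta>. entrance_at (tail \<Gamma> f))"

end

end

(*
  Left multiplication followed by reduction lets every word act on the reduced words with matching
  range, and equivalent words act in the same way.  A reduced word sends the trivial word to
  itself, so each class contains exactly one reduced word (van der Waerden's argument).

  Let U be open and nonempty.  It contains Z(mu) for some path mu with last edge e.  Since some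
  edge f of a repeatable path eta with an entrance can flow to e, mu extends to a path rho ending
  in f, and a cyclic rotation q of eta starts at the source of f and ends in f.  Hence rho q tau
  is reduced whenever rho tau is, so the class of rho q rho^-1 maps V = Z(rho) onto Z(rho q) by
  replacing the prefix rho with rho q.  As V is clopen, it remains to see that Z(rho q) is a proper
  subset: at the entrance, a third letter leads away from q, and by nonsingularity the resulting
  path can be continued to an infinite one.
*)

theory Submission
  imports Defs
begin

text \<open>Whether a letter may be added to a path depends only on the last edge of the path, never
  on the group element in front of that edge. This is why flow from 1e suffices to prolong a path
  that ends in e behind an arbitrary transversal element, and why two paths that end in the same
  edge admit the same continuations. The obstacle is that the action on infinite paths is a limit:
  elements of edge groups carried to the right can alter infinitely many letters, and the result is
  specified only through its eventual initial segments. The contracting element is chosen so that no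
  carry arises. Once rho is stripped off, the tail tau is again reduced, and a path with trivial
  final element is written in front of it unchanged. The value of the action is thus known in
  advance and only has to be checked on finite segments. The inverse of rho enters solely through
  its effect on reduced words.\<close>

lemma (in group) index_le_one:
  assumes "subgroup H G" "carrier G \<subseteq> H"
  shows "index G H \<le> 1"
proof -
  have "a <# H = H" if "a \<in> carrier G" for a
    using coset_join3[OF that assms(1)] assms(2) that by blast
  then have sub: "lcosets H \<subseteq> {H}"
    by (auto simp: LCOSETS_def)
  then have "finite (lcosets H)" "card (lcosets H) \<le> 1"
    using finite_subset[OF sub] card_mono[OF _ sub] by simp_all
  then show ?thesis
    by (simp add: index_def one_enat_def)
qed

section \<open>Sequences with a finite prefix\<close>

primrec prepend :: "'a list \<Rightarrow> (nat \<Rightarrow> 'a) \<Rightarrow> nat \<Rightarrow> 'a" where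
  "prepend [] \<xi> = \<xi>"
| "prepend (a # p) \<xi> = case_nat a (prepend p \<xi>)"

lemma prepend_append: "prepend (p @ q) \<xi> = prepend p (prepend q \<xi>)"
  by (induction p) simp_all

lemma prepend_nth: "i < length p \<Longrightarrow> prepend p \<xi> i = p ! i"
  by (induction p arbitrary: i) (auto split: nat.splits)

lemma prepend_shift: "prepend p \<xi> (length p + n) = \<xi> n"
  by (induction p) simp_all

lemma map_prepend: "map (prepend p \<xi>) [0..<length p + n] = p @ map \<xi> [0..<n]"
proof (rule nth_equalityI)
  fix i assume "i < length (map (prepend p \<xi>) [0..<length p + n])"
  then show "map (prepend p \<xi>) [0..<length p + n] ! i = (p @ map \<xi> [0..<n]) ! i"
    using prepend_shift[of p \<xi> "i - length p"] by (auto simp: nth_append prepend_nth)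
qed simp

lemma prepend_map_upt: "prepend (map \<xi> [0..<n]) (\<lambda>i. \<xi> (n + i)) = \<xi>"
proof
  fix i
  show "prepend (map \<xi> [0..<n]) (\<lambda>i. \<xi> (n + i)) i = \<xi> i"
    using prepend_shift[of "map \<xi> [0..<n]" "\<lambda>i. \<xi> (n + i)" "i - n"]
    by (cases "i < n") (simp_all add: prepend_nth)
qed

context graph_of_groups_transversals
begin

subsection \<open>Coset representatives\<close>

lemma group_GV_head: "e \<in> arcs \<Gamma> \<Longrightarrow> group (GV (head \<Gamma> e))"
  by (simp add: group_GV)

lemma \<alpha>_closed [simp]:
  "e \<in> arcs \<Gamma> \<Longrightarrow> c \<in> carrier (GE e) \<Longrightarrow> \<alpha> e c \<in> carrier (GV (head \<Gamma> e))"
  using \<alpha>_mon by (auto simp: mon_def hom_def)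

lemma \<alpha>_mult:
  "e \<in> arcs \<Gamma> \<Longrightarrow> c \<in> carrier (GE e) \<Longrightarrow> d \<in> carrier (GE e) \<Longrightarrow>
    \<alpha> e (c \<otimes>\<^bsub>GE e\<^esub> d) = \<alpha> e c \<otimes>\<^bsub>GV (head \<Gamma> e)\<^esub> \<alpha> e d"
  using \<alpha>_mon by (auto simp: mon_def hom_def)

lemma \<alpha>_inj: "e \<in> arcs \<Gamma> \<Longrightarrow> inj_on (\<alpha> e) (carrier (GE e))"
  using \<alpha>_mon by (auto simp: mon_def)

lemma \<alpha>_group_hom: "e \<in> arcs \<Gamma> \<Longrightarrow> group_hom (GE e) (GV (head \<Gamma> e)) (\<alpha> e)"
  using \<alpha>_mon group_GE group_GV_head
  by (auto simp: mon_def group_hom_def group_hom_axioms_def)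

lemma \<alpha>_one [simp]: "e \<in> arcs \<Gamma> \<Longrightarrow> \<alpha> e \<one>\<^bsub>GE e\<^esub> = \<one>\<^bsub>GV (head \<Gamma> e)\<^esub>"
  using group_hom.hom_one[OF \<alpha>_group_hom] .

lemma \<alpha>_bar_closed [simp]:
  "e \<in> arcs \<Gamma> \<Longrightarrow> c \<in> carrier (GE e) \<Longrightarrow> \<alpha> (bar e) c \<in> carrier (GV (tail \<Gamma> e))"
  using \<alpha>_closed[of "bar e" c] by (simp add: GE_bar)

lemma \<alpha>_bar_one [simp]: "e \<in> arcs \<Gamma> \<Longrightarrow> \<alpha> (bar e) \<one>\<^bsub>GE e\<^esub> = \<one>\<^bsub>GV (tail \<Gamma> e)\<^esub>"
  using \<alpha>_one[of "bar e"] by (simp add: GE_bar)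

lemma \<alpha>_bar_mult:
  "e \<in> arcs \<Gamma> \<Longrightarrow> c \<in> carrier (GE e) \<Longrightarrow> d \<in> carrier (GE e) \<Longrightarrow>
    \<alpha> (bar e) (c \<otimes>\<^bsub>GE e\<^esub> d) = \<alpha> (bar e) c \<otimes>\<^bsub>GV (tail \<Gamma> e)\<^esub> \<alpha> (bar e) d"
  using \<alpha>_mult[of "bar e" c d] by (simp add: GE_bar)

lemma transversal_closed: "e \<in> arcs \<Gamma> \<Longrightarrow> t \<in> \<Sigma> e \<Longrightarrow> t \<in> carrier (GV (head \<Gamma> e))"
  using transversal by (auto simp: is_transversal_def)

text \<open>Inverting the edge group element turns t = h \<alpha>(c) into h = t \<alpha>(c'), so the
  representatives in question are exactly the points of \<open>\<Sigma> e\<close> in the left coset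
  of h, and the transversal contains one of them.\<close>

lemma transversal_decomposition:
  assumes e: "e \<in> arcs \<Gamma>" and h: "h \<in> carrier (GV (head \<Gamma> e))"
  shows "\<exists>!t. t \<in> \<Sigma> e \<and> (\<exists>c \<in> carrier (GE e). h = t \<otimes>\<^bsub>GV (head \<Gamma> e)\<^esub> \<alpha> e c)"
proof -
  interpret group_hom "GE e" "GV (head \<Gamma> e)" "\<alpha> e"
    using \<alpha>_group_hom[OF e] .
  have coset: "t \<in> h <#\<^bsub>GV (head \<Gamma> e)\<^esub> (\<alpha> e ` carrier (GE e)) \<longleftrightarrow>
      (\<exists>c \<in> carrier (GE e). h = t \<otimes>\<^bsub>GV (head \<Gamma> e)\<^esub> \<alpha> e c)" if "t \<in> \<Sigma> e" for t
  proof -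
    have t: "t \<in> carrier (GV (head \<Gamma> e))"
      using transversal_closed[OF e that] .
    show ?thesis
    proof
      assume "t \<in> h <#\<^bsub>GV (head \<Gamma> e)\<^esub> (\<alpha> e ` carrier (GE e))"
      then obtain c where c: "c \<in> carrier (GE e)" "t = h \<otimes>\<^bsub>GV (head \<Gamma> e)\<^esub> \<alpha> e c"
        by (auto simp: l_coset_def)
      then have "h = t \<otimes>\<^bsub>GV (head \<Gamma> e)\<^esub> \<alpha> e (inv\<^bsub>GE e\<^esub> c)"
        using h by (simp add: H.m_assoc)
      then show "\<exists>c \<in> carrier (GE e). h = t \<otimes>\<^bsub>GV (head \<Gamma> e)\<^esub> \<alpha> e c"
        using c by blast
    next
      assume "\<exists>c \<in> carrier (GE e). h = t \<otimes>\<^bsub>GV (head \<Gamma> e)\<^esub> \<alpha> e c"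
      then obtain c where c: "c \<in> carrier (GE e)" "h = t \<otimes>\<^bsub>GV (head \<Gamma> e)\<^esub> \<alpha> e c"
        by blast
      then have "t = h \<otimes>\<^bsub>GV (head \<Gamma> e)\<^esub> \<alpha> e (inv\<^bsub>GE e\<^esub> c)"
        using t by (simp add: H.m_assoc)
      then show "t \<in> h <#\<^bsub>GV (head \<Gamma> e)\<^esub> (\<alpha> e ` carrier (GE e))"
        using c unfolding l_coset_def by blast
    qed
  qed
  have "h <#\<^bsub>GV (head \<Gamma> e)\<^esub> (\<alpha> e ` carrier (GE e))
      \<in> lcosets\<^bsub>GV (head \<Gamma> e)\<^esub> (\<alpha> e ` carrier (GE e))"
    using h by (auto simp: LCOSETS_def)
  then have "\<exists>!t. t \<in> \<Sigma> e \<and> t \<in> h <#\<^bsub>GV (head \<Gamma> e)\<^esub> (\<alpha> e ` carrier (GE e))"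
    using transversal[OF e] by (simp add: is_transversal_def)
  then show ?thesis
    using coset by (simp cong: conj_cong)
qed

definition coset_rep :: "'e \<Rightarrow> 'g \<Rightarrow> 'g" where
  "coset_rep e h =
    (THE t. t \<in> \<Sigma> e \<and> (\<exists>c \<in> carrier (GE e). h = t \<otimes>\<^bsub>GV (head \<Gamma> e)\<^esub> \<alpha> e c))"

definition edge_part :: "'e \<Rightarrow> 'g \<Rightarrow> 'h" where
  "edge_part e h =
    (THE c. c \<in> carrier (GE e) \<and> h = coset_rep e h \<otimes>\<^bsub>GV (head \<Gamma> e)\<^esub> \<alpha> e c)"

text \<open>The second factor is unique because t cancels in the vertex group and
  \<open>\<alpha> e\<close> is injective.\<close>

lemma coset_rep_edge_part_unique:
  assumes e: "e \<in> arcs \<Gamma>" and t: "t \<in> \<Sigma> e" and c: "c \<in> carrier (GE e)"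
  shows "coset_rep e (t \<otimes>\<^bsub>GV (head \<Gamma> e)\<^esub> \<alpha> e c) = t"
    and "edge_part e (t \<otimes>\<^bsub>GV (head \<Gamma> e)\<^esub> \<alpha> e c) = c"
proof -
  interpret group "GV (head \<Gamma> e)"
    using e by (rule group_GV_head)
  have t': "t \<in> carrier (GV (head \<Gamma> e))"
    using transversal_closed[OF e t] .
  then have h: "t \<otimes>\<^bsub>GV (head \<Gamma> e)\<^esub> \<alpha> e c \<in> carrier (GV (head \<Gamma> e))"
    using e c by simp
  show *: "coset_rep e (t \<otimes>\<^bsub>GV (head \<Gamma> e)\<^esub> \<alpha> e c) = t"
    unfolding coset_rep_def
    by (rule the1_equality[OF transversal_decomposition[OF e h]]) (use t c in blast)
  show "edge_part e (t \<otimes>\<^bsub>GV (head \<Gamma> e)\<^esub> \<alpha> e c) = c"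
    unfolding edge_part_def *
  proof (rule the_equality)
    fix d assume "d \<in> carrier (GE e) \<and>
      t \<otimes>\<^bsub>GV (head \<Gamma> e)\<^esub> \<alpha> e c = t \<otimes>\<^bsub>GV (head \<Gamma> e)\<^esub> \<alpha> e d"
    then have "\<alpha> e d = \<alpha> e c" and "d \<in> carrier (GE e)"
      using e c t' by auto
    then show "d = c"
      using c inj_onD[OF \<alpha>_inj[OF e]] by blast
  qed (use c in simp)
qed

lemma coset_rep_edge_part:
  assumes e: "e \<in> arcs \<Gamma>" and h: "h \<in> carrier (GV (head \<Gamma> e))"
  shows "coset_rep e h \<in> \<Sigma> e" and "edge_part e h \<in> carrier (GE e)"
    and "coset_rep e h \<otimes>\<^bsub>GV (head \<Gamma> e)\<^esub> \<alpha> e (edge_part e h) = h"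
proof -
  obtain t c where "t \<in> \<Sigma> e" "c \<in> carrier (GE e)" "h = t \<otimes>\<^bsub>GV (head \<Gamma> e)\<^esub> \<alpha> e c"
    using transversal_decomposition[OF e h] by blast
  with coset_rep_edge_part_unique[OF e] show "coset_rep e h \<in> \<Sigma> e"
    and "edge_part e h \<in> carrier (GE e)"
    and "coset_rep e h \<otimes>\<^bsub>GV (head \<Gamma> e)\<^esub> \<alpha> e (edge_part e h) = h"
    by auto
qed

lemma coset_rep_transversal:
  assumes "e \<in> arcs \<Gamma>" "t \<in> \<Sigma> e"
  shows "coset_rep e t = t" "edge_part e t = \<one>\<^bsub>GE e\<^esub>"
proof -
  interpret group_hom "GE e" "GV (head \<Gamma> e)" "\<alpha> e"
    using \<alpha>_group_hom assms by blast
  show "coset_rep e t = t" "edge_part e t = \<one>\<^bsub>GE e\<^esub>"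
    using coset_rep_edge_part_unique[OF assms G.one_closed] transversal_closed[OF assms]
    by simp_all
qed

lemma coset_rep_\<alpha>:
  assumes "e \<in> arcs \<Gamma>" "c \<in> carrier (GE e)"
  shows "coset_rep e (\<alpha> e c) = \<one>\<^bsub>GV (head \<Gamma> e)\<^esub>" "edge_part e (\<alpha> e c) = c"
proof -
  interpret group "GV (head \<Gamma> e)"
    using assms by (simp add: group_GV_head)
  show "coset_rep e (\<alpha> e c) = \<one>\<^bsub>GV (head \<Gamma> e)\<^esub>" "edge_part e (\<alpha> e c) = c"
    using coset_rep_edge_part_unique[OF assms(1) one_in_transversal[OF assms(1)] assms(2)] assms
    by simp_all
qed

text \<open>Left multiplication by \<open>\<alpha> e c\<close> permutes the cosets and fixes the
  trivial one, so it cannot make a nontrivial representative trivial. Hence a carry moving through a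
  reduced word never creates a cancellation.\<close>

lemma coset_rep_\<alpha>_mult_eq_one_iff:
  assumes e: "e \<in> arcs \<Gamma>" and c: "c \<in> carrier (GE e)" and t: "t \<in> \<Sigma> e"
  shows "coset_rep e (\<alpha> e c \<otimes>\<^bsub>GV (head \<Gamma> e)\<^esub> t) = \<one>\<^bsub>GV (head \<Gamma> e)\<^esub> \<longleftrightarrow>
    t = \<one>\<^bsub>GV (head \<Gamma> e)\<^esub>" (is "?l \<longleftrightarrow> ?r")
proof -
  interpret group_hom "GE e" "GV (head \<Gamma> e)" "\<alpha> e"
    using \<alpha>_group_hom[OF e] .
  have t': "t \<in> carrier (GV (head \<Gamma> e))"
    using transversal_closed[OF e t] .
  show ?thesis
  proof
    assume ?r
    then show ?l
      using coset_rep_\<alpha>[OF e c] c by simp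
  next
    define d where "d = edge_part e (\<alpha> e c \<otimes>\<^bsub>GV (head \<Gamma> e)\<^esub> t)"
    have d: "d \<in> carrier (GE e)"
      unfolding d_def using e c t' by (simp add: coset_rep_edge_part)
    assume ?l
    then have "\<alpha> e d = \<alpha> e c \<otimes>\<^bsub>GV (head \<Gamma> e)\<^esub> t"
      using coset_rep_edge_part(3)[OF e, of "\<alpha> e c \<otimes>\<^bsub>GV (head \<Gamma> e)\<^esub> t"] c t' d
      by (simp add: d_def)
    then have "t = \<alpha> e (inv\<^bsub>GE e\<^esub> c \<otimes>\<^bsub>GE e\<^esub> d)"
      using c d t' by (simp flip: H.m_assoc)
    then have "coset_rep e t = \<one>\<^bsub>GV (head \<Gamma> e)\<^esub>"
      using coset_rep_\<alpha>(1)[OF e] c d by (simp only: G.m_closed G.inv_closed)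
    then show ?r
      using coset_rep_transversal[OF e t] by simp
  qed
qed

subsection \<open>The action of words on reduced words\<close>

text \<open>The new range is read off from e and the range stored in u is discarded; for this reason
  most facts about it assume \<open>rng u = tail \<Gamma> e\<close>.\<close>

definition wcons :: "'g \<Rightarrow> 'e \<Rightarrow> ('v, 'g, 'e) gword \<Rightarrow> ('v, 'g, 'e) gword" where
  "wcons h e u = (head \<Gamma> e, (h, e) # fst (snd u), snd (snd u))"

lemma rng_wcons [simp]: "rng (wcons h e u) = head \<Gamma> e"
  by (simp add: wcons_def)

lemma src_wcons [simp]: "rng u = tail \<Gamma> e \<Longrightarrow> src (wcons h e u) = src u"
  by (cases u) (auto simp: wcons_def)

lemma wcons_inject [simp]:
  "rng u = rng u' \<Longrightarrow> wcons h e u = wcons h' e' u' \<longleftrightarrow> h = h' \<and> e = e' \<and> u = u'"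
  by (cases u; cases u') (auto simp: wcons_def)

lemma is_word_wcons [simp]:
  "rng u = tail \<Gamma> e \<Longrightarrow> is_word (wcons h e u) \<longleftrightarrow>
    e \<in> arcs \<Gamma> \<and> h \<in> carrier (GV (head \<Gamma> e)) \<and> is_word u"
  by (cases u) (auto simp: wcons_def)

lemma word_cases:
  assumes "is_word w"
  obtains (vertex) x g where "w = (x, [], g)" "x \<in> verts \<Gamma>" "g \<in> carrier (GV x)"
  | (edge) h e u where "w = wcons h e u" "rng u = tail \<Gamma> e" "is_word u" "e \<in> arcs \<Gamma>"
    "h \<in> carrier (GV (head \<Gamma> e))"
proof (cases w)
  case (fields x p g)
  show ?thesis
  proof (cases p)
    case Nil
    then show ?thesis
      using assms fields vertex by simp
  next
    case (Cons a q)
    obtain h e where "a = (h, e)"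
      by (cases a)
    then show ?thesis
      using assms fields Cons edge[of h e "(tail \<Gamma> e, q, g)"] by (auto simp: wcons_def)
  qed
qed

text \<open>As \<open>wcons\<close> is not a constructor, the induction runs over the number of
  letters.\<close>

lemma word_induct [consumes 1, case_names vertex edge]:
  assumes "is_word w"
    and vertex: "\<And>x g. x \<in> verts \<Gamma> \<Longrightarrow> g \<in> carrier (GV x) \<Longrightarrow> P (x, [], g)"
    and edge: "\<And>h e u. e \<in> arcs \<Gamma> \<Longrightarrow> h \<in> carrier (GV (head \<Gamma> e)) \<Longrightarrow> is_word u \<Longrightarrow>
      rng u = tail \<Gamma> e \<Longrightarrow> P u \<Longrightarrow> P (wcons h e u)"
  shows "P w"
  using assms(1)
proof (induction "length (fst (snd w))" arbitrary: w)
  case 0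
  from \<open>is_word w\<close> 0 show ?case
    by (cases w rule: word_cases) (auto simp: wcons_def vertex)
next
  case (Suc n)
  from Suc.prems show ?case
  proof (cases w rule: word_cases)
    case (edge h e u)
    then have "P u"
      using Suc.hyps by (auto simp: wcons_def)
    then show ?thesis
      using edge assms(3) by blast
  qed (use Suc.hyps in simp)
qed

section \<open>Backtracking and the recursive form of reducedness\<close>

definition backtracks :: "'e \<Rightarrow> ('v, 'g, 'e) gword \<Rightarrow> bool" where
  "backtracks e u \<longleftrightarrow>
    (\<exists>u'. rng u' = head \<Gamma> e \<and> u = wcons \<one>\<^bsub>GV (tail \<Gamma> e)\<^esub> (bar e) u')"

lemma backtracks_wcons [simp]:
  "rng u = tail \<Gamma> f \<Longrightarrow> e \<in> arcs \<Gamma> \<Longrightarrow>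
    backtracks e (wcons h f u) \<longleftrightarrow> f = bar e \<and> h = \<one>\<^bsub>GV (tail \<Gamma> e)\<^esub>"
  by (cases u) (auto simp: backtracks_def wcons_def)

lemma not_backtracks_vertex [simp]: "\<not> backtracks e (x, [], g)"
  by (simp add: backtracks_def wcons_def)

lemma reduced_vertex [simp]: "reduced (x, [], g) \<longleftrightarrow> x \<in> verts \<Gamma> \<and> g \<in> carrier (GV x)"
  by simp

text \<open>Conditions on all positions of a list become a recursion: a letter put in front brings
  in only its own membership in the transversal and the junction with the first letter of u.\<close>

lemma reduced_wcons [simp]:
  assumes "rng u = tail \<Gamma> e"
  shows "reduced (wcons h e u) \<longleftrightarrow>
    e \<in> arcs \<Gamma> \<and> h \<in> \<Sigma> e \<and> reduced u \<and> \<not> backtracks e u"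
proof -
  obtain p g where u: "u = (tail \<Gamma> e, p, g)"
    using assms by (cases u) auto
  have split: "(\<forall>i. P i) \<longleftrightarrow> P 0 \<and> (\<forall>i. P (Suc i))" for P
    by (metis nat.exhaust)
  show ?thesis
  proof (cases p)
    case Nil
    then show ?thesis
      using transversal_closed
      by (auto simp: u wcons_def simp del: reduced_vertex)
  next
    case (Cons a q)
    obtain k f where "a = (k, f)"
      by (cases a)
    then have "u = wcons k f (tail \<Gamma> f, q, g)" if "is_word u"
      using Cons that by (auto simp: u wcons_def)
    moreover have "reduced (wcons h e u) \<longleftrightarrow> e \<in> arcs \<Gamma> \<and> h \<in> \<Sigma> e \<and> reduced u \<and>
        (e = bar f \<longrightarrow> k \<noteq> \<one>\<^bsub>GV (head \<Gamma> f)\<^esub>)"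
      unfolding u wcons_def Cons \<open>a = (k, f)\<close> fst_conv snd_conv reduced.simps
      using transversal_closed
      by (subst split) (auto simp: All_less_Suc2)
    moreover have "is_word u" if "reduced u"
      using that by (simp add: u)
    moreover have "backtracks e u \<longleftrightarrow> e = bar f \<and> k = \<one>\<^bsub>GV (head \<Gamma> f)\<^esub>"
      if "u = wcons k f (tail \<Gamma> f, q, g)" "e \<in> arcs \<Gamma>"
      using that arev_in_arcs[of "bar f"] by auto
    ultimately show ?thesis
      by blast
  qed
qed

declare reduced.simps [simp del]

lemma reduced_is_word: "reduced w \<Longrightarrow> is_word w"
  by (cases w) (simp add: reduced.simps)

lemma reduced_induct [consumes 1, case_names vertex edge]:
  assumes "reduced w"
    and "\<And>x g. x \<in> verts \<Gamma> \<Longrightarrow> g \<in> carrier (GV x) \<Longrightarrow> P (x, [], g)"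
    and "\<And>h e u. e \<in> arcs \<Gamma> \<Longrightarrow> h \<in> carrier (GV (head \<Gamma> e)) \<Longrightarrow> h \<in> \<Sigma> e \<Longrightarrow> reduced u \<Longrightarrow>
      rng u = tail \<Gamma> e \<Longrightarrow> \<not> backtracks e u \<Longrightarrow> P u \<Longrightarrow> P (wcons h e u)"
  shows "P w"
proof -
  have "reduced w \<longrightarrow> P w"
    using reduced_is_word[OF assms(1)] by (induction w rule: word_induct) (auto intro: assms)
  then show ?thesis
    using assms(1) by blast
qed

text \<open>
  Left multiplication by an element \<open>a\<close> of a vertex group: write \<open>a h = t \<alpha>\<^sub>e(c)\<close> with
  \<open>t \<in> \<Sigma>\<^sub>e\<close>, and move \<open>\<alpha>\<^sub>e(c)\<close> past \<open>e\<close>, where it becomes \<open>\<alpha>\<^bsub>bar e\<^esub>(c)\<close>.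
\<close>

fun lmul :: "'g \<Rightarrow> ('v, 'g, 'e) gword \<Rightarrow> ('v, 'g, 'e) gword" where
  "lmul a (x, [], g) = (x, [], a \<otimes>\<^bsub>GV x\<^esub> g)"
| "lmul a (x, (h, e) # p, g) = wcons (coset_rep e (a \<otimes>\<^bsub>GV x\<^esub> h)) e
     (lmul (\<alpha> (bar e) (edge_part e (a \<otimes>\<^bsub>GV x\<^esub> h))) (tail \<Gamma> e, p, g))"

lemma lmul_wcons [simp]:
  "rng u = tail \<Gamma> e \<Longrightarrow> lmul a (wcons h e u) =
    wcons (coset_rep e (a \<otimes>\<^bsub>GV (head \<Gamma> e)\<^esub> h)) e
      (lmul (\<alpha> (bar e) (edge_part e (a \<otimes>\<^bsub>GV (head \<Gamma> e)\<^esub> h))) u)"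
  by (cases u) (simp add: wcons_def)

lemma rng_lmul [simp]: "is_word u \<Longrightarrow> rng (lmul a u) = rng u"
  by (cases u rule: word_cases) simp_all

lemma src_lmul [simp]: "is_word u \<Longrightarrow> src (lmul a u) = src u"
  by (induction u arbitrary: a rule: word_induct) simp_all

lemma rng_lmul_reduced [simp]: "reduced u \<Longrightarrow> rng (lmul a u) = rng u"
  and src_lmul_reduced [simp]: "reduced u \<Longrightarrow> src (lmul a u) = src u"
  by (simp_all add: reduced_is_word)

text \<open>Only the first letter of u matters. Its element k is replaced by the representative of
  the product of \<open>\<alpha> (bar e) c\<close> and k, which is trivial only if k is.\<close>

lemma backtracks_lmul:
  assumes e: "e \<in> arcs \<Gamma>" and c: "c \<in> carrier (GE e)"
    and u: "reduced u" "rng u = tail \<Gamma> e"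
  shows "backtracks e (lmul (\<alpha> (bar e) c) u) \<longleftrightarrow> backtracks e u"
  using reduced_is_word[OF u(1)]
proof (cases u rule: word_cases)
  case (edge k f u')
  then show ?thesis
    using coset_rep_\<alpha>_mult_eq_one_iff[of "bar e" c k] e c u by (auto simp: GE_bar)
qed simp

lemma reduced_lmul [simp]:
  "reduced u \<Longrightarrow> a \<in> carrier (GV (rng u)) \<Longrightarrow> reduced (lmul a u)"
proof (induction u arbitrary: a rule: reduced_induct)
  case (vertex x g)
  then interpret group "GV x"
    by (simp add: group_GV)
  show ?case
    using vertex by simp
next
  case (edge h e u)
  interpret group "GV (head \<Gamma> e)"
    using edge by (simp add: group_GV_head)
  show ?case
    using edge by (simp add: coset_rep_edge_part backtracks_lmul reduced_is_word)
qed

lemma lmul_one [simp]: "reduced u \<Longrightarrow> lmul \<one>\<^bsub>GV (rng u)\<^esub> u = u"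
proof (induction u rule: reduced_induct)
  case (vertex x g)
  then interpret group "GV x"
    by (simp add: group_GV)
  show ?case
    using vertex by simp
next
  case (edge h e u)
  interpret group "GV (head \<Gamma> e)"
    using edge by (simp add: group_GV_head)
  show ?case
    using edge by (simp add: coset_rep_transversal)
qed

text \<open>Factoring b h and then the product of a with the representative found gives a b h = t'
  \<alpha>(c' c). The carries multiply in the order in which the induction hypothesis composes them
  on the rest of the word.\<close>

lemma lmul_mult:
  "reduced u \<Longrightarrow> a \<in> carrier (GV (rng u)) \<Longrightarrow> b \<in> carrier (GV (rng u)) \<Longrightarrow>
    lmul (a \<otimes>\<^bsub>GV (rng u)\<^esub> b) u = lmul a (lmul b u)"
proof (induction u arbitrary: a b rule: reduced_induct)
  case (vertex x g)
  then interpret group "GV x"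
    by (simp add: group_GV)
  show ?case
    using vertex by (simp add: m_assoc)
next
  case (edge h e u)
  let ?G = "GV (head \<Gamma> e)"
  interpret group_hom "GE e" ?G "\<alpha> e"
    using \<alpha>_group_hom edge by blast
  define t where "t = coset_rep e (b \<otimes>\<^bsub>?G\<^esub> h)"
  define c where "c = edge_part e (b \<otimes>\<^bsub>?G\<^esub> h)"
  define t' where "t' = coset_rep e (a \<otimes>\<^bsub>?G\<^esub> t)"
  define c' where "c' = edge_part e (a \<otimes>\<^bsub>?G\<^esub> t)"
  have tc: "t \<in> \<Sigma> e" "c \<in> carrier (GE e)" "t \<otimes>\<^bsub>?G\<^esub> \<alpha> e c = b \<otimes>\<^bsub>?G\<^esub> h"
    using edge by (simp_all add: t_def c_def coset_rep_edge_part)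
  have t: "t \<in> carrier ?G"
    using tc edge transversal_closed by blast
  have tc': "t' \<in> \<Sigma> e" "c' \<in> carrier (GE e)" "t' \<otimes>\<^bsub>?G\<^esub> \<alpha> e c' = a \<otimes>\<^bsub>?G\<^esub> t"
    using edge t by (simp_all add: t'_def c'_def coset_rep_edge_part)
  have t': "t' \<in> carrier ?G"
    using tc' edge transversal_closed by blast
  have "a \<otimes>\<^bsub>?G\<^esub> b \<otimes>\<^bsub>?G\<^esub> h = a \<otimes>\<^bsub>?G\<^esub> (b \<otimes>\<^bsub>?G\<^esub> h)"
    using edge by (simp add: H.m_assoc)
  also have "\<dots> = (a \<otimes>\<^bsub>?G\<^esub> t) \<otimes>\<^bsub>?G\<^esub> \<alpha> e c"
    using edge t tc by (simp add: H.m_assoc flip: tc(3))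
  also have "\<dots> = t' \<otimes>\<^bsub>?G\<^esub> \<alpha> e (c' \<otimes>\<^bsub>GE e\<^esub> c)"
    using edge t' tc tc' by (simp add: H.m_assoc flip: tc'(3))
  finally have "coset_rep e (a \<otimes>\<^bsub>?G\<^esub> b \<otimes>\<^bsub>?G\<^esub> h) = t'"
    "edge_part e (a \<otimes>\<^bsub>?G\<^esub> b \<otimes>\<^bsub>?G\<^esub> h) = c' \<otimes>\<^bsub>GE e\<^esub> c"
    using coset_rep_edge_part_unique[OF \<open>e \<in> arcs \<Gamma>\<close> tc'(1), of "c' \<otimes>\<^bsub>GE e\<^esub> c"] tc tc'
    by simp_all
  moreover have "lmul (\<alpha> (bar e) (c' \<otimes>\<^bsub>GE e\<^esub> c)) u
      = lmul (\<alpha> (bar e) c') (lmul (\<alpha> (bar e) c) u)"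
    using edge.IH[of "\<alpha> (bar e) c'" "\<alpha> (bar e) c"] edge tc tc' by (simp add: \<alpha>_bar_mult)
  ultimately show ?case
    using edge by (simp add: t_def c_def t'_def c'_def reduced_is_word)
qed

text \<open>Left multiplication by the edge e on reduced words. Dropping the letter 1
  \<open>bar e\<close> in the cancelling case is what makes the operations of e and
  \<open>bar e\<close> inverse to each other.\<close>

definition epush :: "'e \<Rightarrow> ('v, 'g, 'e) gword \<Rightarrow> ('v, 'g, 'e) gword" where
  "epush e u = (if backtracks e u then (head \<Gamma> e, tl (fst (snd u)), snd (snd u))
    else wcons \<one>\<^bsub>GV (head \<Gamma> e)\<^esub> e u)"

lemma epush_bar_wcons [simp]:
  "e \<in> arcs \<Gamma> \<Longrightarrow> rng u = head \<Gamma> e \<Longrightarrow> epush e (wcons \<one>\<^bsub>GV (tail \<Gamma> e)\<^esub> (bar e) u) = u"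
  by (cases u) (simp add: epush_def, simp add: wcons_def)

lemma epush_wcons [simp]:
  "\<not> backtracks e u \<Longrightarrow> epush e u = wcons \<one>\<^bsub>GV (head \<Gamma> e)\<^esub> e u"
  by (simp add: epush_def)

text \<open>In the first case reducedness of u also prevents u' from starting with 1e, so pushing
  \<open>bar e\<close> onto u' restores u.\<close>

lemma epush_cases:
  assumes "e \<in> arcs \<Gamma>" "rng u = tail \<Gamma> e" "reduced u"
  obtains (backtrack) u' where "u = wcons \<one>\<^bsub>GV (tail \<Gamma> e)\<^esub> (bar e) u'" "rng u' = head \<Gamma> e"
    "reduced u'" "\<not> backtracks (bar e) u'" "epush e u = u'"
  | (push) "\<not> backtracks e u" "epush e u = wcons \<one>\<^bsub>GV (head \<Gamma> e)\<^esub> e u"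
  using assms by (cases "backtracks e u") (auto simp: backtracks_def)

lemma epush_reduced:
  assumes "e \<in> arcs \<Gamma>" "rng u = tail \<Gamma> e" "reduced u"
  shows reduced_epush [simp]: "reduced (epush e u)"
    and rng_epush [simp]: "rng (epush e u) = head \<Gamma> e"
    and src_epush [simp]: "src (epush e u) = src u"
  using assms one_in_transversal by (cases rule: epush_cases[OF assms]; auto)+

lemma epush_epush_bar [simp]:
  assumes "e \<in> arcs \<Gamma>" "rng u = head \<Gamma> e" "reduced u"
  shows "epush e (epush (bar e) u) = u"
  by (cases rule: epush_cases[of "bar e" u]) (use assms in auto)

text \<open>The edge relation on the level of the action. If u starts with 1 \<open>bar e\<close>,
  the carry passes this letter and both sides multiply the remainder by \<open>\<alpha> e c\<close>.
  Otherwise e stays in front on both sides: \<open>\<alpha> e c\<close> has trivial representative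
  and carry c, and the multiplication by \<open>\<alpha> (bar e) c\<close> creates no
  backtracking.\<close>

lemma epush_slide:
  assumes e: "e \<in> arcs \<Gamma>" and u: "rng u = tail \<Gamma> e" "reduced u" and c: "c \<in> carrier (GE e)"
  shows "epush e (lmul (\<alpha> (bar e) c) u) = lmul (\<alpha> e c) (epush e u)"
  using e u
proof (cases rule: epush_cases)
  case (backtrack u')
  interpret group "GV (tail \<Gamma> e)"
    using e by (simp add: group_GV)
  show ?thesis
    using backtrack e c coset_rep_\<alpha>[of "bar e" c] by (simp add: GE_bar reduced_is_word)
next
  case push
  interpret group "GV (head \<Gamma> e)"
    using e by (simp add: group_GV)
  show ?thesis
    using push e c u by (simp add: coset_rep_\<alpha> backtracks_lmul)
qed

lemma lmul_epush:
  assumes "reduced (wcons h e u)" "rng u = tail \<Gamma> e"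
  shows "lmul h (epush e u) = wcons h e u"
proof -
  interpret group "GV (head \<Gamma> e)"
    using assms by (simp add: group_GV)
  show ?thesis
    using assms lmul_one[of u] by (simp add: coset_rep_transversal transversal_closed)
qed

fun act :: "('v, 'g, 'e) gword \<Rightarrow> ('v, 'g, 'e) gword \<Rightarrow> ('v, 'g, 'e) gword" where
  "act (x, [], g) u = lmul g u"
| "act (x, (h, e) # p, g) u = lmul h (epush e (act (tail \<Gamma> e, p, g) u))"

lemma act_wcons [simp]:
  "rng w = tail \<Gamma> e \<Longrightarrow> act (wcons h e w) u = lmul h (epush e (act w u))"
  by (cases w) (simp add: wcons_def)

lemma act_reduced:
  assumes "is_word w" "reduced u" "rng u = src w"
  shows reduced_act [simp]: "reduced (act w u)"
    and rng_act [simp]: "rng (act w u) = rng w"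
    and src_act [simp]: "src (act w u) = src u"
proof -
  have "reduced (act w u) \<and> rng (act w u) = rng w \<and> src (act w u) = src u"
    using assms by (induction w rule: word_induct) (auto simp: reduced_is_word)
  then show "reduced (act w u)" "rng (act w u) = rng w" "src (act w u) = src u"
    by blast+
qed

lemma wconcat_wcons [simp]:
  "rng w = tail \<Gamma> e \<Longrightarrow> wconcat (wcons h e w) u = wcons h e (wconcat w u)"
  by (cases "(w, u)" rule: wconcat.cases) (auto simp: wcons_def)

lemma wconcat_vertex_wcons [simp]:
  "wconcat (head \<Gamma> e, [], g) (wcons h e u) = wcons (g \<otimes>\<^bsub>GV (head \<Gamma> e)\<^esub> h) e u"
  by (cases u) (simp add: wcons_def)

lemma rng_wconcat [simp]: "rng (wconcat w u) = rng w"
  by (cases "(w, u)" rule: wconcat.cases) auto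

lemma wconcat_word:
  assumes "is_word w" "is_word u" "src w = rng u"
  shows is_word_wconcat [simp]: "is_word (wconcat w u)"
    and src_wconcat [simp]: "src (wconcat w u) = src u"
proof -
  have "is_word (wconcat w u) \<and> src (wconcat w u) = src u"
    using assms
  proof (induction w rule: word_induct)
    case (vertex x g)
    then interpret group "GV x"
      by (simp add: group_GV)
    from \<open>is_word u\<close> show ?case
      by (cases u rule: word_cases) (use vertex m_closed in auto)
  qed auto
  then show "is_word (wconcat w u)" "src (wconcat w u) = src u"
    by blast+
qed

text \<open>Concatenation multiplies the two vertex group elements at the junction;
  \<open>lmul_mult\<close> splits this product again.\<close>

lemma act_wconcat:
  assumes "is_word w" "is_word w'" "src w = rng w'" "reduced u" "rng u = src w'"
  shows "act (wconcat w w') u = act w (act w' u)"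
  using assms
proof (induction w rule: word_induct)
  case (vertex x g)
  from \<open>is_word w'\<close> show ?case
  proof (cases w' rule: word_cases)
    case (vertex y h)
    then show ?thesis
      using vertex.prems vertex.hyps lmul_mult[of u g h] by simp
  next
    case (edge h e w'')
    then show ?thesis
      using vertex.prems vertex.hyps lmul_mult[of "epush e (act w'' u)" g h] by simp
  qed
qed auto

lemma edge_word_wcons:
  "edge_word e = wcons \<one>\<^bsub>GV (head \<Gamma> e)\<^esub> e (tail \<Gamma> e, [], \<one>\<^bsub>GV (tail \<Gamma> e)\<^esub>)"
  by (simp add: edge_word_def wcons_def)

subsection \<open>Uniqueness of reduced words\<close>

lemma is_word_edge_word [simp]: "e \<in> arcs \<Gamma> \<Longrightarrow> is_word (edge_word e)"
  by (simp add: edge_word_wcons group.is_monoid group_GV)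

lemma rng_edge_word [simp]: "rng (edge_word e) = head \<Gamma> e"
  by (simp add: edge_word_wcons)

lemma src_edge_word [simp]: "src (edge_word e) = tail \<Gamma> e"
  by (simp add: edge_word_wcons)

lemma is_word_vertex_word [simp]:
  "is_word (vertex_word x g) \<longleftrightarrow> x \<in> verts \<Gamma> \<and> g \<in> carrier (GV x)"
  by (simp add: vertex_word_def)

lemma rng_vertex_word [simp]: "rng (vertex_word x g) = x"
  by (simp add: vertex_word_def)

lemma src_vertex_word [simp]: "src (vertex_word x g) = x"
  by (simp add: vertex_word_def)

lemma act_vertex_word [simp]: "act (vertex_word x g) u = lmul g u"
  by (simp add: vertex_word_def)

lemma act_edge_word [simp]:
  assumes "e \<in> arcs \<Gamma>" "reduced u" "rng u = tail \<Gamma> e"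
  shows "act (edge_word e) u = epush e u"
  using assms lmul_one[of u] lmul_one[of "epush e u"] by (simp add: edge_word_wcons)

lemma one_closed_GV [simp]: "x \<in> verts \<Gamma> \<Longrightarrow> \<one>\<^bsub>GV x\<^esub> \<in> carrier (GV x)"
  by (simp add: group.is_monoid group_GV)

text \<open>Cancellation acts trivially because e and \<open>bar e\<close> push inversely, sliding
  is \<open>epush_slide\<close>, and concatenation becomes composition. Word, range and source
  conditions are part of the same induction since the composition makes sense only for matching
  words.\<close>

lemma word_eq_invariants:
  "w \<sim> w' \<Longrightarrow> is_word w \<and> is_word w' \<and> rng w = rng w' \<and> src w = src w' \<and>
    (\<forall>u. reduced u \<and> rng u = src w \<longrightarrow> act w u = act w' u)"
proof (induction rule: word_eq.induct)
  case (concat w w' u u')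
  then show ?case
    by (simp add: act_wconcat del: split_paired_All)
next
  case (cancel e)
  have "act (wconcat (edge_word e) (edge_word (bar e))) u = lmul \<one>\<^bsub>GV (head \<Gamma> e)\<^esub> u"
    if "reduced u" "rng u = head \<Gamma> e" for u
    using cancel that lmul_one[of u] by (simp add: act_wconcat)
  then show ?case
    using cancel by simp
next
  case (slide e g)
  then show ?case
    by (simp add: act_wconcat epush_slide del: split_paired_All)
qed auto

lemma wconcat_one_left [simp]:
  assumes "is_word u" "rng u = x"
  shows "wconcat (x, [], \<one>\<^bsub>GV x\<^esub>) u = u"
  using assms(1)
proof (cases u rule: word_cases)
  case (vertex y g)
  then show ?thesis
    using assms by (simp add: group.is_monoid group_GV)
next
  case (edge h e u')
  interpret group "GV (head \<Gamma> e)"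
    using edge by (simp add: group_GV)
  show ?thesis
    using assms edge by auto
qed

section \<open>Acting on a reduced word stays in the class of the concatenation\<close>

declare word_eq.trans [trans]

lemma word_eq_wcons:
  assumes "u \<sim> u'" "rng u = tail \<Gamma> e" "e \<in> arcs \<Gamma>" "h \<in> carrier (GV (head \<Gamma> e))"
  shows "wcons h e u \<sim> wcons h e u'"
proof -
  let ?w = "wcons h e (tail \<Gamma> e, [], \<one>\<^bsub>GV (tail \<Gamma> e)\<^esub>)"
  have "wconcat ?w u \<sim> wconcat ?w u'"
    using assms by (intro word_eq.concat word_eq.refl) simp_all
  then show ?thesis
    using assms word_eq_invariants[OF assms(1)] by simp
qed

text \<open>The generating relation concerns a bare edge; concatenating it with u on the right and t
  on the left places it inside a word.\<close>

lemma word_eq_slide: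
  assumes e: "e \<in> arcs \<Gamma>" and c: "c \<in> carrier (GE e)" and t: "t \<in> carrier (GV (head \<Gamma> e))"
    and u: "is_word u" "rng u = tail \<Gamma> e"
  shows "wcons (t \<otimes>\<^bsub>GV (head \<Gamma> e)\<^esub> \<alpha> e c) e u \<sim>
    wcons t e (wconcat (vertex_word (tail \<Gamma> e) (\<alpha> (bar e) c)) u)"
proof -
  interpret group "GV (head \<Gamma> e)"
    using e by (simp add: group_GV)
  interpret T: group "GV (tail \<Gamma> e)"
    using e by (simp add: group_GV)
  have "wcons (\<alpha> e c) e (tail \<Gamma> e, [], \<one>\<^bsub>GV (tail \<Gamma> e)\<^esub>) \<sim>
      wcons \<one>\<^bsub>GV (head \<Gamma> e)\<^esub> e (vertex_word (tail \<Gamma> e) (\<alpha> (bar e) c))"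
    using word_eq.sym[OF word_eq.slide[OF e c]] e c
    by (simp add: edge_word_wcons vertex_word_def)
  from word_eq.concat[OF this word_eq.refl[OF u(1)]]
  have "wcons (\<alpha> e c) e u \<sim>
      wcons \<one>\<^bsub>GV (head \<Gamma> e)\<^esub> e (wconcat (vertex_word (tail \<Gamma> e) (\<alpha> (bar e) c)) u)"
    using u by simp
  from word_eq.concat[OF word_eq.refl[of "(head \<Gamma> e, [], t)"] this]
  show ?thesis
    using e t by simp
qed

text \<open>Each step of the recursion of \<open>lmul\<close> is one slide relation, applied to the
  factorisation of the product of a and h.\<close>

lemma word_eq_lmul:
  assumes "reduced u" "a \<in> carrier (GV (rng u))"
  shows "wconcat (vertex_word (rng u) a) u \<sim> lmul a u"
  using assms
proof (induction u arbitrary: a rule: reduced_induct)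
  case (vertex x g)
  then interpret group "GV x"
    by (simp add: group_GV)
  show ?case
    using vertex by (auto simp: vertex_word_def intro: word_eq.refl)
next
  case (edge h e u)
  let ?G = "GV (head \<Gamma> e)"
  interpret group ?G
    using edge by (simp add: group_GV)
  define t where "t = coset_rep e (a \<otimes>\<^bsub>?G\<^esub> h)"
  define c where "c = edge_part e (a \<otimes>\<^bsub>?G\<^esub> h)"
  have tc: "t \<in> \<Sigma> e" "c \<in> carrier (GE e)" "t \<otimes>\<^bsub>?G\<^esub> \<alpha> e c = a \<otimes>\<^bsub>?G\<^esub> h"
    using edge by (simp_all add: t_def c_def coset_rep_edge_part)
  have t: "t \<in> carrier ?G"
    using tc edge transversal_closed by blast
  have "wcons (t \<otimes>\<^bsub>?G\<^esub> \<alpha> e c) e u \<sim>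
      wcons t e (wconcat (vertex_word (tail \<Gamma> e) (\<alpha> (bar e) c)) u)"
    using edge tc t by (intro word_eq_slide) (simp_all add: reduced_is_word)
  also have "wcons t e (wconcat (vertex_word (tail \<Gamma> e) (\<alpha> (bar e) c)) u) \<sim>
      wcons t e (lmul (\<alpha> (bar e) c) u)"
    using edge.IH[of "\<alpha> (bar e) c"] edge tc t by (intro word_eq_wcons) simp_all
  finally show ?case
    using edge by (simp add: tc(3) vertex_word_def flip: t_def c_def)
qed

lemma word_eq_epush:
  assumes e: "e \<in> arcs \<Gamma>" and u: "reduced u" "rng u = tail \<Gamma> e"
  shows "wcons \<one>\<^bsub>GV (head \<Gamma> e)\<^esub> e u \<sim> epush e u"
  using e u(2,1)
proof (cases rule: epush_cases)
  case (backtrack u')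
  have "wconcat (wconcat (edge_word e) (edge_word (bar e))) u' \<sim>
      wconcat (vertex_word (head \<Gamma> e) \<one>\<^bsub>GV (head \<Gamma> e)\<^esub>) u'"
    using e backtrack by (intro word_eq.concat word_eq.cancel word_eq.refl)
      (simp_all add: reduced_is_word)
  moreover have "edge_word (bar e)
      = wcons \<one>\<^bsub>GV (tail \<Gamma> e)\<^esub> (bar e) (head \<Gamma> e, [], \<one>\<^bsub>GV (head \<Gamma> e)\<^esub>)"
    using e by (simp add: edge_word_wcons)
  ultimately show ?thesis
    using e backtrack by (simp add: vertex_word_def reduced_is_word edge_word_wcons[of e])
next
  case push
  then show ?thesis
    using e u by (simp add: word_eq.refl reduced_is_word)
qed

text \<open>Every operation that makes up \<open>act\<close> is realised by defining relations.
  Together with the uniqueness of reduced words this makes \<open>act\<close> a way to compute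
  reductions.\<close>

lemma word_eq_act:
  assumes "is_word w" "reduced u" "rng u = src w"
  shows "wconcat w u \<sim> act w u"
  using assms
proof (induction w rule: word_induct)
  case (vertex x g)
  then show ?case
    using word_eq_lmul[of u g] by (simp add: vertex_word_def)
next
  case (edge h e w)
  interpret group "GV (head \<Gamma> e)"
    using edge by (simp add: group_GV)
  have "wcons h e (wconcat w u) \<sim> wcons h e (act w u)"
    using edge by (intro word_eq_wcons) simp_all
  also have "wcons h e (act w u)
      = wconcat (vertex_word (head \<Gamma> e) h) (wcons \<one>\<^bsub>GV (head \<Gamma> e)\<^esub> e (act w u))"
    using edge by (simp add: vertex_word_def)
  also have "\<dots> \<sim> wconcat (vertex_word (head \<Gamma> e) h) (epush e (act w u))"
    using edge by (intro word_eq.concat word_eq.refl word_eq_epush) simp_all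
  also have "\<dots> \<sim> lmul h (epush e (act w u))"
    using edge word_eq_lmul[of "epush e (act w u)" h] by simp
  finally show ?case
    using edge by simp
qed

text \<open>The elements of a reduced word already lie in the transversals and its edges do not
  cancel, so acting by p merely writes p in front. The element k is kept general to cover both a
  path with trivial final element acting on its continuation and a reduced word acting on the unit
  word.\<close>

lemma act_append:
  assumes "reduced (x, p @ q, g)" "lmul k u = (src (x, p, k), q, g)"
  shows "act (x, p, k) u = (x, p @ q, g)"
  using assms
proof (induction p arbitrary: x)
  case (Cons a p)
  obtain h e where a: "a = (h, e)"
    by (cases a)
  have x: "x = head \<Gamma> e"
    using reduced_is_word[OF Cons.prems(1)] a by simp
  have w: "(x, (h, e) # p @ q, g) = wcons h e (tail \<Gamma> e, p @ q, g)"
    by (simp add: x wcons_def)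
  have red: "reduced (wcons h e (tail \<Gamma> e, p @ q, g))"
    using Cons.prems(1) by (simp add: a flip: w)
  have "act (tail \<Gamma> e, p, k) u = (tail \<Gamma> e, p @ q, g)"
    using Cons.prems red by (intro Cons.IH) (auto simp: a)
  then show ?case
    using lmul_epush[OF red] by (simp add: a w)
qed simp

definition unit_word :: "'v \<Rightarrow> ('v, 'g, 'e) gword" where
  "unit_word x = (x, [], \<one>\<^bsub>GV x\<^esub>)"

lemma rng_unit_word [simp]: "rng (unit_word x) = x"
  by (simp add: unit_word_def)

lemma reduced_unit_word [simp]: "reduced (unit_word x) \<longleftrightarrow> x \<in> verts \<Gamma>"
  by (auto simp: unit_word_def)

lemma src_in_verts [simp]: "is_word w \<Longrightarrow> src w \<in> verts \<Gamma>"
  by (induction w rule: word_induct) simp_all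

lemma src_closed: "is_word (x, p, g) \<Longrightarrow> g \<in> carrier (GV (src (x, p, g)))"
  by (induction p arbitrary: x) auto

lemma wconcat_unit_word [simp]:
  assumes "is_word w"
  shows "wconcat w (unit_word (src w)) = w"
proof -
  obtain x p g where w: "w = (x, p, g)"
    by (cases w)
  interpret group "GV (src (x, p, g))"
    using assms w by (simp add: group_GV del: src.simps)
  show ?thesis
    using src_closed assms w by (auto simp: unit_word_def simp del: src.simps)
qed

lemma act_unit_word [simp]:
  assumes "reduced w"
  shows "act w (unit_word (src w)) = w"
proof -
  obtain x p g where w: "w = (x, p, g)"
    by (cases w)
  interpret group "GV (src (x, p, g))"
    using assms w by (simp add: group_GV reduced_is_word del: src.simps)
  show ?thesis
    using act_append[of x p "[]" g] src_closed[of x p g] assms w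
    by (simp add: unit_word_def reduced_is_word del: src.simps)
qed

lemma reduced_word_eq_unique:
  assumes "reduced w" "reduced w'" "w \<sim> w'"
  shows "w = w'"
  using assms word_eq_invariants[OF assms(3)] act_unit_word[of w] act_unit_word[of w']
  by (metis reduced_unit_word rng_unit_word src_in_verts)

section \<open>Reductions, inverses and the action on infinite paths\<close>

lemma reduction_eq: "reduced u \<Longrightarrow> w \<sim> u \<Longrightarrow> reduction w = u"
  unfolding reduction_def
  by (rule the_equality) (auto intro: reduced_word_eq_unique word_eq.trans word_eq.sym)

lemma reduction_wconcat:
  "is_word w \<Longrightarrow> reduced u \<Longrightarrow> rng u = src w \<Longrightarrow> reduction (wconcat w u) = act w u"
  by (intro reduction_eq word_eq_act) simp_all

text \<open>The inverse of h e w is built recursively as the inverse of w followed by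
  \<open>bar e\<close> and the inverse of h; \<open>lmul_mult\<close> and
  \<open>epush_epush_bar\<close> show that its action undoes that of the word.\<close>

lemma inverse_word:
  assumes "is_word w"
  obtains w' where "is_word w'" "rng w' = src w" "src w' = rng w"
    "\<And>u. reduced u \<Longrightarrow> rng u = src w \<Longrightarrow> act w' (act w u) = u"
proof -
  have "\<exists>w'. is_word w' \<and> rng w' = src w \<and> src w' = rng w \<and>
    (\<forall>u. reduced u \<and> rng u = src w \<longrightarrow> act w' (act w u) = u)"
    using assms
  proof (induction w rule: word_induct)
    case (vertex x g)
    then interpret group "GV x"
      by (simp add: group_GV)
    have "lmul (inv\<^bsub>GV x\<^esub> g) (lmul g u) = u" if "reduced u" "rng u = x" for u
      using lmul_mult[of u "inv\<^bsub>GV x\<^esub> g" g] lmul_one[of u] that vertex by simp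
    then show ?case
      using vertex by (intro exI[of _ "(x, [], inv\<^bsub>GV x\<^esub> g)"]) simp
  next
    case (edge h e w)
    interpret group "GV (head \<Gamma> e)"
      using edge by (simp add: group_GV)
    obtain w' where w': "is_word w'" "rng w' = src w" "src w' = rng w"
      "\<And>u. reduced u \<Longrightarrow> rng u = src w \<Longrightarrow> act w' (act w u) = u"
      using edge by blast
    let ?v = "wconcat (edge_word (bar e)) (vertex_word (head \<Gamma> e) (inv\<^bsub>GV (head \<Gamma> e)\<^esub> h))"
    have "lmul (inv\<^bsub>GV (head \<Gamma> e)\<^esub> h) (lmul h u) = u" if "reduced u" "rng u = head \<Gamma> e" for u
      using lmul_mult[of u "inv\<^bsub>GV (head \<Gamma> e)\<^esub> h" h] lmul_one[of u] that edge by simp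
    moreover have "epush (bar e) (epush e u) = u" if "reduced u" "rng u = tail \<Gamma> e" for u
      using epush_epush_bar[of "bar e" u] edge that by simp
    ultimately have "act (wconcat w' ?v) (act (wcons h e w) u) = u"
      if "reduced u" "rng u = src w" for u
      using that edge.hyps w' by (simp add: act_wconcat)
    then show ?case
      using edge w' by (intro exI[of _ "wconcat w' ?v"]) simp
  qed
  then show ?thesis
    using that by blast
qed

text \<open>Identifies the representative chosen in the definition of \<open>action\<close>: it is
  the result of acting on the unit word.\<close>

lemma reduced_representative:
  assumes "is_word w"
  shows "(THE w'. w' \<in> {w'. w \<sim> w'} \<and> reduced w') = act w (unit_word (src w))"
    and "w \<sim> act w (unit_word (src w))"
proof -
  show *: "w \<sim> act w (unit_word (src w))"
    using word_eq_act[OF assms, of "unit_word (src w)"] assms by simp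
  show "(THE w'. w' \<in> {w'. w \<sim> w'} \<and> reduced w') = act w (unit_word (src w))"
  proof (rule the_equality)
    show "act w (unit_word (src w)) \<in> {w'. w \<sim> w'} \<and> reduced (act w (unit_word (src w)))"
      using * assms by simp
    then show "w' = act w (unit_word (src w))" if "w' \<in> {w'. w \<sim> w'} \<and> reduced w'" for w'
      using that by (auto intro: reduced_word_eq_unique word_eq.trans word_eq.sym)
  qed
qed

lemma rng_segment [simp]: "rng (segment \<xi> n) = head \<Gamma> (snd (\<xi> 0))"
  by (simp add: segment_def Let_def)

text \<open>Replaces both definite descriptions behind \<open>action\<close> by a check of a
  candidate \<eta>. The reduced representative of the class may be exchanged for w because
  equivalent words act alike.\<close>

lemma action_eq:
  assumes w: "is_word w" and \<xi>: "infinite_path \<xi>" "head \<Gamma> (snd (\<xi> 0)) = src w"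
    and \<eta>: "\<eta> \<in> boundary (rng w)"
    and ev: "\<And>k. \<forall>\<^sub>F n in sequentially. \<exists>q h. act w (segment \<xi> n) = (rng w, map \<eta> [0..<k] @ q, h)"
  shows "action {w'. w \<sim> w'} \<xi> = \<eta>"
proof -
  define w0 where "w0 = act w (unit_word (src w))"
  have w0: "w \<sim> w0" "(THE w'. w' \<in> {w'. w \<sim> w'} \<and> reduced w') = w0"
    unfolding w0_def using reduced_representative[OF w] by auto
  have inv: "is_word w0" "rng w0 = rng w" "src w0 = src w"
    "\<And>u. reduced u \<Longrightarrow> rng u = src w \<Longrightarrow> act w0 u = act w u"
    using word_eq_invariants[OF w0(1)] by auto
  have seg: "reduction (wconcat w0 (segment \<xi> n)) = act w (segment \<xi> n)" for n
  proof -
    have "reduced (segment \<xi> n)" "rng (segment \<xi> n) = src w"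
      using \<xi> by (auto simp: infinite_path_def is_path_def)
    then show ?thesis
      using inv by (simp add: reduction_wconcat)
  qed
  have "concat_reduce w0 \<xi> = \<eta>"
    unfolding concat_reduce_def seg inv(2)
  proof (rule the_equality)
    fix \<eta>'
    assume "\<eta>' \<in> boundary (rng w) \<and> (\<forall>k. \<forall>\<^sub>F n in sequentially.
      \<exists>q h. act w (segment \<xi> n) = (rng w, map \<eta>' [0..<k] @ q, h))"
    then have "\<forall>\<^sub>F n in sequentially. \<exists>q h. act w (segment \<xi> n) = (rng w, map \<eta>' [0..<k] @ q, h)"
      for k by blast
    \<comment> \<open>Two eventual properties hold at a common n, where both prefixes of length k
      are read off the same word.\<close>
    then have "\<exists>n. (\<exists>q h. act w (segment \<xi> n) = (rng w, map \<eta>' [0..<k] @ q, h)) \<and>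
        (\<exists>q h. act w (segment \<xi> n) = (rng w, map \<eta> [0..<k] @ q, h))" for k
      using eventually_happens'[OF sequentially_bot eventually_conj] ev by blast
    then have eq: "map \<eta>' [0..<k] = map \<eta> [0..<k]" for k
      by (metis Pair_inject append_eq_append_conv length_map)
    show "\<eta>' = \<eta>"
    proof
      fix k
      show "\<eta>' k = \<eta> k"
        using eq[of "Suc k"] by simp
    qed
  qed (use \<eta> ev in simp)
  then show ?thesis
    unfolding action_def w0(2) .
qed

subsection \<open>Paths as chains of letters\<close>

definition letter :: "'g \<times> 'e \<Rightarrow> bool" where
  "letter a \<longleftrightarrow> snd a \<in> arcs \<Gamma> \<and> fst a \<in> \<Sigma> (snd a)"

definition follows :: "'g \<times> 'e \<Rightarrow> 'g \<times> 'e \<Rightarrow> bool" where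
  "follows a b \<longleftrightarrow>
    head \<Gamma> (snd b) = tail \<Gamma> (snd a) \<and> b \<noteq> (\<one>\<^bsub>GV (tail \<Gamma> (snd a))\<^esub>, bar (snd a))"

text \<open>A path stripped of its range and its final element. All conditions concern single
  letters or neighbouring ones, so splicing and rotating paths become operations on lists.\<close>

definition chain :: "('g \<times> 'e) list \<Rightarrow> bool" where
  "chain p \<longleftrightarrow> (\<forall>a \<in> set p. letter a) \<and> successively follows p"

lemma follows_snd_cong: "snd a = snd a' \<Longrightarrow> follows a b \<longleftrightarrow> follows a' b"
  by (simp add: follows_def)

lemma chain_Nil [simp]: "chain []"
  by (simp add: chain_def)

lemma chain_append:
  "chain (p @ q) \<longleftrightarrow>
    chain p \<and> chain q \<and> (p = [] \<or> q = [] \<or> follows (last p) (hd q))"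
  by (auto simp: chain_def successively_append_iff)

lemma chain_Cons: "chain (a # p) \<longleftrightarrow> letter a \<and> chain p \<and> (p = [] \<or> follows a (hd p))"
  by (auto simp: chain_def successively_Cons)

lemma reduced_iff_chain:
  "reduced (x, p, g) \<longleftrightarrow> x \<in> verts \<Gamma> \<and> g \<in> carrier (GV (src (x, p, g))) \<and> chain p \<and>
    (p = [] \<or> head \<Gamma> (snd (hd p)) = x)"
proof (induction p arbitrary: x)
  case (Cons a p)
  obtain h e where a: "a = (h, e)"
    by (cases a)
  show ?case
  proof (cases "e \<in> arcs \<Gamma> \<and> head \<Gamma> e = x")
    case True
    have bt: "backtracks e (tail \<Gamma> e, p, g) \<longleftrightarrow>
        p \<noteq> [] \<and> hd p = (\<one>\<^bsub>GV (tail \<Gamma> e)\<^esub>, bar e)"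
    proof (cases p)
      case (Cons b q)
      show ?thesis
      proof
        assume "p \<noteq> [] \<and> hd p = (\<one>\<^bsub>GV (tail \<Gamma> e)\<^esub>, bar e)"
        then have "(tail \<Gamma> e, p, g) = wcons \<one>\<^bsub>GV (tail \<Gamma> e)\<^esub> (bar e) (head \<Gamma> e, q, g)"
          using Cons True by (simp add: wcons_def)
        then show "backtracks e (tail \<Gamma> e, p, g)"
          unfolding backtracks_def by fastforce
      qed (auto simp: backtracks_def wcons_def)
    qed simp
    have w: "(x, a # p, g) = wcons h e (tail \<Gamma> e, p, g)"
      using True by (simp add: a wcons_def)
    have "reduced (x, a # p, g) \<longleftrightarrow>
        e \<in> arcs \<Gamma> \<and> h \<in> \<Sigma> e \<and> reduced (tail \<Gamma> e, p, g) \<and> \<not> backtracks e (tail \<Gamma> e, p, g)"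
      unfolding w by (rule reduced_wcons) simp
    also have "\<dots> \<longleftrightarrow> x \<in> verts \<Gamma> \<and> g \<in> carrier (GV (src (x, a # p, g))) \<and> chain (a # p) \<and>
        (a # p = [] \<or> head \<Gamma> (snd (hd (a # p))) = x)"
      using True unfolding bt Cons.IH by (auto simp: chain_Cons a letter_def follows_def)
    finally show ?thesis .
  next
    case False
    moreover have "e \<in> arcs \<Gamma> \<and> head \<Gamma> e = x" if "reduced (x, a # p, g)"
      using reduced_is_word[OF that] by (simp add: a)
    moreover have "e \<in> arcs \<Gamma>" if "chain (a # p)"
      using that by (simp add: a chain_Cons letter_def)
    ultimately show ?thesis
      by (auto simp del: src.simps simp: a)
  qed
qed simp

definition infinite_chain :: "(nat \<Rightarrow> 'g \<times> 'e) \<Rightarrow> bool" where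
  "infinite_chain \<xi> \<longleftrightarrow> (\<forall>n. letter (\<xi> n) \<and> follows (\<xi> n) (\<xi> (Suc n)))"

lemma chain_map_upt: "infinite_chain \<xi> \<Longrightarrow> chain (map \<xi> [0..<n])"
proof (induction n)
  case (Suc n)
  then show ?case
    by (cases n) (simp_all add: chain_append chain_Cons infinite_chain_def)
qed simp

lemma infinite_path_iff_chain: "infinite_path \<xi> \<longleftrightarrow> infinite_chain \<xi>"
proof
  assume path: "infinite_path \<xi>"
  show "infinite_chain \<xi>"
    unfolding infinite_chain_def
  proof
    fix n
    \<comment> \<open>This is the shortest segment that contains both \<open>\<xi> n\<close> and
      \<open>\<xi> (Suc n)\<close>.\<close>
    have "reduced (segment \<xi> (Suc (Suc n)))"
      using path by (simp add: infinite_path_def is_path_def)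
    then have "chain (map \<xi> [0..<n] @ [\<xi> n, \<xi> (Suc n)])"
      by (simp add: segment_def Let_def reduced_iff_chain)
    then show "letter (\<xi> n) \<and> follows (\<xi> n) (\<xi> (Suc n))"
      by (simp add: chain_append chain_Cons)
  qed
next
  assume chain: "infinite_chain \<xi>"
  have arcs: "snd (\<xi> n) \<in> arcs \<Gamma>" for n
    using chain by (simp add: infinite_chain_def letter_def)
  show "infinite_path \<xi>"
    unfolding infinite_path_def
  proof
    fix n
    show "is_path (segment \<xi> n)"
    proof (cases n)
      case 0
      then show ?thesis
        using arcs[of 0] by (simp add: is_path_def segment_def Let_def)
    next
      case (Suc m)
      show ?thesis
        using chain_map_upt[OF chain, of n] arcs[of 0] arcs[of m]
        by (simp add: Suc is_path_def segment_def Let_def reduced_iff_chain hd_map last_map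
          del: upt_Suc)
    qed
  qed
qed

lemma boundary_eq: "boundary v = {\<xi>. infinite_chain \<xi> \<and> head \<Gamma> (snd (\<xi> 0)) = v}"
  by (simp add: boundary_def infinite_path_iff_chain)

lemma reduced_segment: "infinite_chain \<xi> \<Longrightarrow> reduced (segment \<xi> n)"
  by (simp add: infinite_path_def is_path_def flip: infinite_path_iff_chain)

text \<open>The ranges are compared separately because for n = 0 the empty list of letters does not
  determine them.\<close>

lemma segment_eq_iff:
  "segment \<zeta> m = segment \<xi> n \<longleftrightarrow>
    m = n \<and> map \<zeta> [0..<n] = map \<xi> [0..<n] \<and> head \<Gamma> (snd (\<zeta> 0)) = head \<Gamma> (snd (\<xi> 0))"
proof -
  have "m = n" if "map \<zeta> [0..<m] = map \<xi> [0..<n]"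
    using arg_cong[OF that, of length] by simp
  moreover have "\<zeta> (n - 1) = \<xi> (n - 1)" if "map \<zeta> [0..<n] = map \<xi> [0..<n]" "n \<noteq> 0"
    using that by (simp add: map_eq_conv)
  ultimately show ?thesis
    by (auto simp: segment_def Let_def)
qed

lemma Z_segment:
  "Z (segment \<xi> n) = {\<zeta>. infinite_chain \<zeta> \<and> (\<forall>i < n. \<zeta> i = \<xi> i) \<and>
    head \<Gamma> (snd (\<zeta> 0)) = head \<Gamma> (snd (\<xi> 0))}"
  by (auto simp: Z_def segment_eq_iff infinite_path_iff_chain map_eq_conv)

lemma Z_segment_antimono: "m \<le> n \<Longrightarrow> Z (segment \<xi> n) \<subseteq> Z (segment \<xi> m)"
  by (auto simp: Z_segment)

subsection \<open>The topology of the boundary\<close>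

lemma openin_Z_segment:
  "\<xi> \<in> boundary v \<Longrightarrow> openin (boundary_topology v) (Z (segment \<xi> n))"
  unfolding boundary_topology_def
  by (intro topology_generated_by_Basis CollectI exI[of _ "segment \<xi> n"])
    (simp add: boundary_def infinite_path_def)

lemma mem_Z_segment: "\<xi> \<in> boundary v \<Longrightarrow> \<xi> \<in> Z (segment \<xi> n)"
  by (simp add: Z_segment boundary_eq)

lemma Z_segment_subset_boundary: "\<xi> \<in> boundary v \<Longrightarrow> Z (segment \<xi> n) \<subseteq> boundary v"
  by (auto simp: Z_segment boundary_eq)

lemma topspace_boundary_topology [simp]: "topspace (boundary_topology v) = boundary v"
proof
  show "topspace (boundary_topology v) \<subseteq> boundary v"
  proof
    fix \<xi> assume "\<xi> \<in> topspace (boundary_topology v)"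
    then obtain \<mu> where "\<xi> \<in> Z \<mu>" "rng \<mu> = v"
      by (auto simp: boundary_topology_def simp del: split_paired_Ex)
    then show "\<xi> \<in> boundary v"
      by (auto simp: Z_def boundary_def)
  qed
  show "boundary v \<subseteq> topspace (boundary_topology v)"
    using openin_Z_segment mem_Z_segment openin_subset by blast
qed

text \<open>The cylinders around \<xi> are nested, so in the induction over the generated topology
  an intersection is handled by the longer of two segments.\<close>

lemma openin_boundary_topologyD:
  assumes "openin (boundary_topology v) U" "\<xi> \<in> U"
  shows "\<exists>n. Z (segment \<xi> n) \<subseteq> U"
  using assms unfolding boundary_topology_def openin_topology_generated_by_iff
proof (induction U rule: generate_topology_on.induct)
  case (Int a b)
  then obtain m n where "Z (segment \<xi> m) \<subseteq> a" "Z (segment \<xi> n) \<subseteq> b"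
    by auto
  then have "Z (segment \<xi> (max m n)) \<subseteq> a \<inter> b"
    using Z_segment_antimono[of m "max m n" \<xi>] Z_segment_antimono[of n "max m n" \<xi>] by auto
  then show ?case
    by blast
next
  case (UN K)
  then show ?case
    by (meson Union_iff Union_upper order_trans)
next
  case (Basis s)
  then obtain \<mu> n where "s = Z \<mu>" "segment \<xi> n = \<mu>"
    by (auto simp: Z_def simp del: split_paired_Ex)
  then show ?case
    by blast
qed simp

text \<open>Cylinders over segments of equal length coincide or are disjoint, so each point outside
  lies in a cylinder that misses the given one.\<close>

lemma closedin_Z_segment:
  assumes "\<xi> \<in> boundary v"
  shows "closedin (boundary_topology v) (Z (segment \<xi> n))"
  unfolding closedin_def topspace_boundary_topology
proof
  show "openin (boundary_topology v) (boundary v - Z (segment \<xi> n))"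
  proof (subst openin_subopen, intro ballI)
    fix \<zeta> assume "\<zeta> \<in> boundary v - Z (segment \<xi> n)"
    then have \<zeta>: "\<zeta> \<in> boundary v" "\<zeta> \<notin> Z (segment \<xi> n)"
      by blast+
    then have "Z (segment \<zeta> n) \<inter> Z (segment \<xi> n) = {}"
      by (auto simp: Z_segment boundary_eq)
    then have "Z (segment \<zeta> n) \<subseteq> boundary v - Z (segment \<xi> n)"
      using Z_segment_subset_boundary[OF \<zeta>(1), of n] by blast
    with openin_Z_segment[OF \<zeta>(1)] mem_Z_segment[OF \<zeta>(1)]
    show "\<exists>T. openin (boundary_topology v) T \<and> \<zeta> \<in> T \<and> T \<subseteq> boundary v - Z (segment \<xi> n)"
      by (intro exI[of _ "Z (segment \<zeta> n)"] conjI)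
  qed
qed (rule Z_segment_subset_boundary[OF assms])

subsection \<open>Extending finite and infinite paths\<close>

lemma infinite_chain_case_nat:
  "infinite_chain (case_nat a \<xi>) \<longleftrightarrow> letter a \<and> follows a (\<xi> 0) \<and> infinite_chain \<xi>"
  unfolding infinite_chain_def
  by (auto split: nat.splits)

lemma infinite_chain_prepend:
  "infinite_chain (prepend p \<xi>) \<longleftrightarrow>
    chain p \<and> infinite_chain \<xi> \<and> (p = [] \<or> follows (last p) (\<xi> 0))"
proof (induction p)
  case (Cons a p)
  have "prepend p \<xi> 0 = (if p = [] then \<xi> 0 else hd p)"
    by (cases p) simp_all
  with Cons show ?case
    by (auto simp: infinite_chain_case_nat chain_Cons)
qed simp

text \<open>The only forbidden letter pairs the reverse edge with the trivial element. Any other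
  edge into the same vertex can be used with the trivial element. If there is none, nonsingularity
  makes the image of the edge group proper, and an element outside it has a nontrivial
  representative.\<close>

lemma exists_next_letter:
  assumes "nonsingular" "letter a"
  shows "\<exists>b. letter b \<and> follows a b"
proof -
  define e where "e = bar (snd a)"
  have a: "snd a \<in> arcs \<Gamma>"
    using assms by (simp add: letter_def)
  then have e: "e \<in> arcs \<Gamma>" "head \<Gamma> e = tail \<Gamma> (snd a)"
    by (simp_all add: e_def)
  let ?G = "GV (head \<Gamma> e)"
  interpret group_hom "GE e" ?G "\<alpha> e"
    using \<alpha>_group_hom[OF e(1)] .
  show ?thesis
  proof (cases "in_arcs \<Gamma> (head \<Gamma> e) = {e}")
    case False
    moreover have "e \<in> in_arcs \<Gamma> (head \<Gamma> e)"
      using e by simp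
    ultimately obtain f where "f \<in> in_arcs \<Gamma> (head \<Gamma> e)" "f \<noteq> e"
      by blast
    then show ?thesis
      using one_in_transversal[of f] e
      by (intro exI[of _ "(\<one>\<^bsub>?G\<^esub>, f)"]) (auto simp: letter_def follows_def e_def)
  next
    case True
    let ?H = "\<alpha> e ` carrier (GE e)"
    have index: "index ?G ?H > 1"
      using assms(1) True e(1) unfolding nonsingular_def by blast
    have "\<not> carrier ?G \<subseteq> ?H"
      using H.index_le_one[OF img_is_subgroup] index by (meson not_le)
    then obtain h where h: "h \<in> carrier ?G" "h \<notin> ?H"
      by blast
    have "coset_rep e h \<noteq> \<one>\<^bsub>?G\<^esub>"
    proof
      assume "coset_rep e h = \<one>\<^bsub>?G\<^esub>"
      then have "\<alpha> e (edge_part e h) = h"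
        using coset_rep_edge_part(2,3)[OF e(1) h(1)] by simp
      then show False
        using h(2) imageI[OF coset_rep_edge_part(2)[OF e(1) h(1)], of "\<alpha> e"] by simp
    qed
    moreover have "coset_rep e h \<in> \<Sigma> e"
      by (rule coset_rep_edge_part(1)[OF e(1) h(1)])
    ultimately show ?thesis
      using e by (intro exI[of _ "(coset_rep e h, e)"]) (simp add: letter_def follows_def)
  qed
qed

lemma exists_infinite_chain:
  assumes "nonsingular" "letter a"
  obtains \<xi> where "infinite_chain \<xi>" "\<xi> 0 = a"
proof -
  have "\<exists>\<xi>. \<forall>n. (letter (\<xi> n) \<and> (n = 0 \<longrightarrow> \<xi> n = a)) \<and> follows (\<xi> n) (\<xi> (Suc n))"
    using assms exists_next_letter
    by (intro dependent_nat_choice) (simp_all del: split_paired_Ex)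
  then show ?thesis
    using that unfolding infinite_chain_def by blast
qed

lemma exists_third_letter:
  assumes "entrance_at x"
  obtains c where "letter c" "head \<Gamma> (snd c) = x" "c \<noteq> a" "c \<noteq> b"
proof (rule ccontr)
  assume no: "\<not> thesis"
  let ?L = "SIGMA f:in_arcs \<Gamma> x. \<Sigma> f"
  \<comment> \<open>\<open>SIGMA\<close> lists the edge before the group element, the reverse of the
    order in a letter; hence the swaps.\<close>
  have sub: "?L \<subseteq> {prod.swap a, prod.swap b}"
    using no that by (force simp: letter_def)
  then have fin: "finite ?L"
    by (rule finite_subset) simp
  \<comment> \<open>A sum over an infinite set is 0 by convention, which the bound 3
    excludes.\<close>
  have fin_in: "finite (in_arcs \<Gamma> x)"
    using assms by (force simp: entrance_at_def intro: ccontr)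
  moreover have "finite (\<Sigma> f)" if "f \<in> in_arcs \<Gamma> x" for f
    using finite_subset[of "\<Sigma> f" "snd ` ?L"] fin that by force
  ultimately have "card ?L = (\<Sum>f \<in> in_arcs \<Gamma> x. card (\<Sigma> f))"
    by simp
  moreover have "card ?L \<le> 2"
    using card_mono[OF _ sub] card_insert_le_m1[of 2 "{prod.swap b}" "prod.swap a"] by simp
  ultimately show False
    using assms by (simp add: entrance_at_def)
qed

subsection \<open>Contraction\<close>

lemma act_path_append:
  assumes "reduced (x, p @ q, g)" "p \<noteq> []" "y = tail \<Gamma> (snd (last p))"
  shows "act (x, p, \<one>\<^bsub>GV y\<^esub>) (y, q, g) = (x, p @ q, g)" "reduced (y, q, g)"
    and "is_word (x, p, \<one>\<^bsub>GV y\<^esub>)"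
proof -
  have "snd (last p) \<in> arcs \<Gamma>"
    using assms by (auto simp: reduced_iff_chain chain_def letter_def)
  then have y: "y \<in> verts \<Gamma>"
    using assms by simp
  have "is_word (x, p, \<one>\<^bsub>GV y\<^esub>)" if "chain p" "p \<noteq> []" "x \<in> verts \<Gamma>" "head \<Gamma> (snd (hd p)) = x"
    using that y assms(3) by (intro reduced_is_word) (simp add: reduced_iff_chain)
  then show "is_word (x, p, \<one>\<^bsub>GV y\<^esub>)"
    using assms by (auto simp: reduced_iff_chain chain_append)
  show red: "reduced (y, q, g)"
    using assms y by (auto simp: reduced_iff_chain chain_append follows_def)
  show "act (x, p, \<one>\<^bsub>GV y\<^esub>) (y, q, g) = (x, p @ q, g)"
    using assms lmul_one[OF red] by (intro act_append) simp_all
qed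

text \<open>Repeatability says that the first letter may follow the last one, so the letters form a
  cycle, which is cut open after an occurrence of f. Equality of the letter sets carries the
  entrance over to q.\<close>

lemma repeatable_rotation:
  assumes "repeatable (x, p, g)" "f \<in> snd ` set p"
  obtains q where "chain q" "q \<noteq> []" "set q = set p" "snd (last q) = f"
    "follows (last q) (hd q)"
proof -
  have p: "chain p" "p \<noteq> []" "follows (last p) (hd p)"
    using assms(1) by (auto simp: is_path_def reduced_iff_chain follows_def)
  obtain b where "b \<in> set p" "snd b = f"
    using assms(2) by blast
  then obtain p1 p2 where p12: "p = p1 @ b # p2" "snd b = f"
    by (meson split_list)
  show ?thesis
  proof (rule that[of "p2 @ p1 @ [b]"])
    show "chain (p2 @ p1 @ [b])"
      using p p12 by (cases p1; cases p2) (auto simp: chain_append chain_Cons hd_append)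
    show "follows (last (p2 @ p1 @ [b])) (hd (p2 @ p1 @ [b]))"
      using p p12 by (cases p1; cases p2) (auto simp: chain_append chain_Cons)
  qed (use p12 in auto)
qed

text \<open>The word is \<rho> q followed by an inverse of \<rho>. Since q and \<rho> end in the
  same edge, a continuation of \<rho> is also one of \<rho> q, and exchanging the prefix leaves the
  tail untouched.\<close>

lemma action_prepend:
  assumes \<rho>: "\<rho> \<noteq> []" and \<rho>q: "chain (\<rho> @ q)" and q: "q \<noteq> []" "snd (last q) = snd (last \<rho>)"
  obtains w where "is_word w" "rng w = head \<Gamma> (snd (hd \<rho>))" "src w = head \<Gamma> (snd (hd \<rho>))"
    "\<And>\<tau>. infinite_chain (prepend \<rho> \<tau>) \<Longrightarrow> infinite_chain (prepend (\<rho> @ q) \<tau>)"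
    "\<And>\<tau>. infinite_chain (prepend \<rho> \<tau>) \<Longrightarrow>
      action {w'. w \<sim> w'} (prepend \<rho> \<tau>) = prepend (\<rho> @ q) \<tau>"
proof -
  define v where "v = head \<Gamma> (snd (hd \<rho>))"
  define y where "y = tail \<Gamma> (snd (last \<rho>))"
  have arcs: "snd a \<in> arcs \<Gamma>" if "a \<in> set \<rho>" for a
    using \<rho>q that by (simp add: chain_def letter_def)
  have verts: "v \<in> verts \<Gamma>" "y \<in> verts \<Gamma>"
    using arcs[of "hd \<rho>"] arcs[of "last \<rho>"] \<rho> by (simp_all add: v_def y_def)
  have \<rho>_word: "is_word (v, \<rho>, \<one>\<^bsub>GV y\<^esub>)" "src (v, \<rho>, \<one>\<^bsub>GV y\<^esub>) = y"
    using \<rho> \<rho>q verts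
    by (auto intro!: reduced_is_word simp: reduced_iff_chain chain_append v_def y_def)
  have \<rho>q_word: "is_word (v, \<rho> @ q, \<one>\<^bsub>GV y\<^esub>)" "src (v, \<rho> @ q, \<one>\<^bsub>GV y\<^esub>) = y"
    using \<rho> \<rho>q q verts by (auto intro!: reduced_is_word simp: reduced_iff_chain v_def y_def)
  obtain w' where w': "is_word w'" "rng w' = y" "src w' = v"
    "\<And>u. reduced u \<Longrightarrow> rng u = y \<Longrightarrow> act w' (act (v, \<rho>, \<one>\<^bsub>GV y\<^esub>) u) = u"
    using inverse_word[OF \<rho>_word(1)] \<rho>_word(2) by (metis rng.simps)
  define w where "w = wconcat (v, \<rho> @ q, \<one>\<^bsub>GV y\<^esub>) w'"
  have w: "is_word w" "rng w = v" "src w = v"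
    using \<rho>q_word w' by (simp_all add: w_def del: src.simps)
  have chain: "infinite_chain (prepend (\<rho> @ q) \<tau>)" if "infinite_chain (prepend \<rho> \<tau>)" for \<tau>
    using that \<rho> \<rho>q q follows_snd_cong[OF q(2)] by (simp add: infinite_chain_prepend)
  have hd_prepend: "prepend \<rho> \<tau> 0 = hd \<rho>" "prepend (\<rho> @ q) \<tau> 0 = hd \<rho>" for \<tau>
    using \<rho> by (cases \<rho>; simp)+
  have "action {w'. w \<sim> w'} (prepend \<rho> \<tau>) = prepend (\<rho> @ q) \<tau>"
    if \<tau>: "infinite_chain (prepend \<rho> \<tau>)" for \<tau>
  proof (rule action_eq[OF w(1)])
    show "infinite_path (prepend \<rho> \<tau>)"
      using \<tau> by (simp add: infinite_path_iff_chain)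
    show "head \<Gamma> (snd (prepend \<rho> \<tau> 0)) = src w"
      by (simp add: w hd_prepend v_def)
    show "prepend (\<rho> @ q) \<tau> \<in> boundary (rng w)"
      using chain[OF \<tau>] by (simp add: boundary_eq w hd_prepend v_def)
    show "\<forall>\<^sub>F n in sequentially. \<exists>r h.
      act w (segment (prepend \<rho> \<tau>) n) = (rng w, map (prepend (\<rho> @ q) \<tau>) [0..<k] @ r, h)" for k
    proof (rule eventually_sequentiallyI)
      \<comment> \<open>Stripping \<rho> off the segment leaves m = n - \<open>length \<rho>\<close>
        letters of \<tau>; m \<ge> k ensures that the word obtained shows at least k letters of the
        limit.\<close>
      fix n assume n: "length \<rho> + k \<le> n"
      define m where "m = n - length \<rho>"
      have m: "n = length \<rho> + m" "k \<le> m"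
        using n by (simp_all add: m_def)
      obtain g where seg: "segment (prepend \<rho> \<tau>) n = (v, \<rho> @ map \<tau> [0..<m], g)"
        by (simp add: segment_def Let_def map_prepend m(1) hd_prepend flip: v_def)
      have red: "reduced (v, \<rho> @ map \<tau> [0..<m], g)"
        using reduced_segment[OF \<tau>, of n] by (simp add: seg)
      \<comment> \<open>For m = 0 the final element g stands directly behind q; it lies in the right
        vertex group because \<rho> and q have the same source.\<close>
      have red': "reduced (v, (\<rho> @ q) @ map \<tau> [0..<m], g)"
        using red chain_map_upt[OF chain[OF \<tau>], of "length (\<rho> @ q) + m"] q \<rho>
        unfolding map_prepend by (cases "m = 0") (simp_all add: reduced_iff_chain)
      let ?u = "(y, map \<tau> [0..<m], g)"
      have u: "act (v, \<rho>, \<one>\<^bsub>GV y\<^esub>) ?u = segment (prepend \<rho> \<tau>) n" "reduced ?u"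
        using act_path_append[OF red \<rho> y_def] seg by simp_all
      have "act w (segment (prepend \<rho> \<tau>) n)
          = act (v, \<rho> @ q, \<one>\<^bsub>GV y\<^esub>) (act w' (act (v, \<rho>, \<one>\<^bsub>GV y\<^esub>) ?u))"
        unfolding w_def u(1) using w' \<rho>q_word reduced_segment[OF \<tau>, of n]
        by (intro act_wconcat) (simp_all add: hd_prepend v_def)
      also have "\<dots> = act (v, \<rho> @ q, \<one>\<^bsub>GV y\<^esub>) ?u"
        using w'(4)[OF u(2)] by simp
      also have "\<dots> = (v, (\<rho> @ q) @ map \<tau> [0..<m], g)"
        using act_path_append(1)[OF red', of y] q \<rho> by (simp add: y_def)
      also have "(\<rho> @ q) @ map \<tau> [0..<m] = map (prepend (\<rho> @ q) \<tau>) [0..<length (\<rho> @ q) + m]"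
        by (rule map_prepend[symmetric])
      also have "[0..<length (\<rho> @ q) + m] = [0..<k] @ [k..<length (\<rho> @ q) + m]"
        using m upt_add_eq_append[of 0 k "length (\<rho> @ q) + m - k"] by simp
      finally show "\<exists>r h. act w (segment (prepend \<rho> \<tau>) n)
          = (rng w, map (prepend (\<rho> @ q) \<tau>) [0..<k] @ r, h)"
        by (simp add: w)
    qed
  qed
  then show ?thesis
    using that w chain by (simp add: v_def)
qed

lemma locally_contractive_boundary:
  assumes nonsingular
    and flow: "\<And>e. e \<in> arcs \<Gamma> \<Longrightarrow>
      \<exists>\<eta>. repeatable \<eta> \<and> has_entrance \<eta> \<and> (\<exists>f \<in> edges \<eta>. can_flow_to f e)"
  shows "locally_contractive (pi1 v) (boundary_topology v) action"
  unfolding locally_contractive_def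
proof (intro allI impI, elim conjE)
  fix U assume U: "openin (boundary_topology v) U" "U \<noteq> {}"
  then obtain \<xi> where \<xi>U: "\<xi> \<in> U"
    by blast
  then obtain N where N: "Z (segment \<xi> N) \<subseteq> U"
    using U openin_boundary_topologyD by blast
  have "\<xi> \<in> boundary v"
    using openin_subset[OF U(1)] \<xi>U by auto
  then have \<xi>: "infinite_chain \<xi>" "head \<Gamma> (snd (\<xi> 0)) = v"
    by (simp_all add: boundary_eq)
  \<comment> \<open>\<open>segment \<xi> N\<close> ends before the letter \<open>\<xi> N\<close>.
    Taking this letter along provides an edge to flow from even when N = 0, and only shrinks the
    cylinder.\<close>
  define e where "e = snd (\<xi> N)"
  have "e \<in> arcs \<Gamma>"
    using \<xi> by (simp add: e_def infinite_chain_def letter_def)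
  then obtain x p g f where \<eta>: "repeatable (x, p, g)" "has_entrance (x, p, g)"
    and f: "f \<in> snd ` set p" "can_flow_to f e"
    using flow by fastforce
  obtain q where q: "chain q" "q \<noteq> []" "set q = set p" "snd (last q) = f" "follows (last q) (hd q)"
    using repeatable_rotation[OF \<eta>(1) f(1)] .
  obtain \<zeta> i n where "infinite_chain \<zeta>" "segment \<zeta> n = edge_word e" "i \<ge> 1" "snd (\<zeta> i) = f"
    using f(2) by (auto simp: can_flow_to_def Z_def infinite_path_iff_chain)
  then have \<zeta>: "infinite_chain \<zeta>" "snd (\<zeta> 0) = e" "1 \<le> i" "snd (\<zeta> i) = f"
    by (cases n; auto simp: segment_def edge_word_def Let_def)+
  \<comment> \<open>Letter 0 of \<zeta> is 1e and gives way to \<open>\<xi> N\<close>, which has the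
    same edge. As i \<ge> 1, something of \<zeta> remains and \<rho> ends in f.\<close>
  define \<rho> where "\<rho> = map \<xi> [0..<Suc N] @ map \<zeta> [1..<Suc i]"
  have upt: "[0..<Suc i] = 0 # [1..<Suc i]"
    by (simp add: upt_conv_Cons)
  have "chain (\<zeta> 0 # map \<zeta> [1..<Suc i])"
    using chain_map_upt[OF \<zeta>(1), of "Suc i"] unfolding upt list.map .
  moreover have hd_\<zeta>: "map \<zeta> [1..<Suc i] \<noteq> []"
    using \<zeta>(3) by simp
  ultimately have "chain (map \<zeta> [1..<Suc i])" "follows (\<zeta> 0) (hd (map \<zeta> [1..<Suc i]))"
    unfolding chain_Cons by blast+
  moreover have "follows (last (map \<xi> [0..<Suc N])) b \<longleftrightarrow> follows (\<zeta> 0) b" for b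
    using \<zeta>(2) by (intro follows_snd_cong) (simp add: e_def)
  ultimately have "chain \<rho>"
    unfolding \<rho>_def chain_append using chain_map_upt[OF \<xi>(1)] by blast
  have last_\<rho>: "snd (last \<rho>) = f" and \<rho>: "\<rho> \<noteq> []" and hd_\<rho>: "hd \<rho> = \<xi> 0"
    using \<zeta> by (simp_all add: \<rho>_def hd_append hd_map last_map del: upt_Suc)
  have \<rho>q: "chain (\<rho> @ q)"
    unfolding chain_append using \<open>chain \<rho>\<close> q follows_snd_cong[of "last \<rho>" "last q"] last_\<rho> by simp
  obtain w where w: "is_word w" "rng w = v" "src w = v"
    and extend: "\<And>\<tau>. infinite_chain (prepend \<rho> \<tau>) \<Longrightarrow> infinite_chain (prepend (\<rho> @ q) \<tau>)"
    and action: "\<And>\<tau>. infinite_chain (prepend \<rho> \<tau>) \<Longrightarrow>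
      action {w'. w \<sim> w'} (prepend \<rho> \<tau>) = prepend (\<rho> @ q) \<tau>"
    using action_prepend[OF \<rho> \<rho>q q(2)] q(4) last_\<rho> hd_\<rho> \<xi>(2) by metis
  obtain b where b: "b \<in> set q" "entrance_at (tail \<Gamma> (snd b))"
    using \<eta>(2) q(3) by (auto simp: has_entrance_def)
  \<comment> \<open>Here c is a letter of q whose predecessor in \<rho> q leads to the entrance. If
    b is the last letter of q, its successor is outside q; then c is the first letter of q, because
    the last letter of \<rho> has the same edge f as b.\<close>
  obtain q1 c q2 where q12: "q = q1 @ c # q2" "snd (last (\<rho> @ q1)) = snd b"
  proof -
    obtain r1 r2 where r: "q = r1 @ b # r2"
      using split_list[OF b(1)] by blast
    show ?thesis
    proof (cases r2)
      case Nil
      then show ?thesis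
        using that[of "[]" "hd q" "tl q"] r q last_\<rho> by simp
    next
      case (Cons c q2)
      then show ?thesis
        using that[of "r1 @ [b]" c q2] r by simp
    qed
  qed
  \<comment> \<open>Of three letters at the entrance, one differs both from c, which would stay on
    q, and from the backtracking letter.\<close>
  obtain d where d: "letter d" "head \<Gamma> (snd d) = tail \<Gamma> (snd b)" "d \<noteq> c"
    "d \<noteq> (\<one>\<^bsub>GV (tail \<Gamma> (snd b))\<^esub>, bar (snd b))"
    using exists_third_letter[OF b(2)] .
  obtain \<theta> where \<theta>: "infinite_chain \<theta>" "\<theta> 0 = d"
    using exists_infinite_chain[OF assms(1) d(1)] .
  \<comment> \<open>\<kappa> leaves \<rho> q right behind q1 and witnesses properness. It also
    begins with \<rho>, so the cylinder of \<rho> can be written as one of a segment of an infinite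
    path, the form in which openness and closedness are available.\<close>
  define \<kappa> where "\<kappa> = prepend (\<rho> @ q1) \<theta>"
  have \<kappa>: "infinite_chain \<kappa>"
    unfolding \<kappa>_def infinite_chain_prepend
    using \<theta> d q12 \<rho>q \<rho> by (auto simp: chain_append follows_def)
  have \<kappa>_nth: "\<kappa> j = \<rho> ! j" if "j < length \<rho>" for j
    using that by (simp add: \<kappa>_def prepend_append prepend_nth)
  have \<kappa>0: "\<kappa> 0 = \<xi> 0"
    using \<kappa>_nth[of 0] \<rho> hd_\<rho> by (simp add: hd_conv_nth)
  have \<kappa>_boundary: "\<kappa> \<in> boundary v"
    using \<kappa> \<kappa>0 \<xi> by (simp add: boundary_eq)
  define V where "V = Z (segment \<kappa> (length \<rho>))"
  have V: "V = prepend \<rho> ` {\<tau>. infinite_chain (prepend \<rho> \<tau>)}"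
  proof
    show "V \<subseteq> prepend \<rho> ` {\<tau>. infinite_chain (prepend \<rho> \<tau>)}"
    proof
      fix \<sigma> assume "\<sigma> \<in> V"
      then have "infinite_chain \<sigma>" "map \<sigma> [0..<length \<rho>] = \<rho>"
        by (auto simp: V_def Z_segment \<kappa>_nth intro!: nth_equalityI)
      then show "\<sigma> \<in> prepend \<rho> ` {\<tau>. infinite_chain (prepend \<rho> \<tau>)}"
        using prepend_map_upt[of \<sigma> "length \<rho>"] by (metis (mono_tags) image_eqI mem_Collect_eq)
    qed
    show "prepend \<rho> ` {\<tau>. infinite_chain (prepend \<rho> \<tau>)} \<subseteq> V"
      using \<rho> by (auto simp: V_def Z_segment \<kappa>_nth prepend_nth)
  qed
  show "\<exists>V \<gamma>. openin (boundary_topology v) V \<and> V \<subseteq> U \<and> \<gamma> \<in> carrier (pi1 v) \<and>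
    action \<gamma> ` (boundary_topology v closure_of V) \<subset> V"
  proof (intro exI conjI)
    show "openin (boundary_topology v) V"
      unfolding V_def by (rule openin_Z_segment[OF \<kappa>_boundary])
    have "V \<subseteq> Z (segment \<xi> N)"
      by (auto simp: V_def Z_segment \<kappa>_nth \<kappa>0) (simp add: \<rho>_def nth_append)
    then show "V \<subseteq> U"
      using N by blast
    have "\<exists>u. {w'. w \<sim> w'} = {w'. u \<sim> w'} \<and> is_word u \<and> rng u = v \<and> src u = v"
      using w by (intro exI[of _ w]) simp
    then show "{w'. w \<sim> w'} \<in> carrier (pi1 v)"
      by (simp add: pi1_def del: split_paired_Ex)
    have "closedin (boundary_topology v) V"
      unfolding V_def by (rule closedin_Z_segment[OF \<kappa>_boundary])
    then have image: "action {w'. w \<sim> w'} ` (boundary_topology v closure_of V)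
        = prepend (\<rho> @ q) ` {\<tau>. infinite_chain (prepend \<rho> \<tau>)}"
      by (simp add: closure_of_closedin V image_image action)
    have "prepend (\<rho> @ q) ` {\<tau>. infinite_chain (prepend \<rho> \<tau>)} \<subseteq> V"
      unfolding V using extend by (auto simp: prepend_append)
    moreover have "\<kappa> \<in> V"
      unfolding V_def by (rule mem_Z_segment[OF \<kappa>_boundary])
    moreover have "\<kappa> \<noteq> prepend (\<rho> @ q) \<tau>" for \<tau>
    proof
      assume "\<kappa> = prepend (\<rho> @ q) \<tau>"
      then have "\<kappa> (length (\<rho> @ q1)) = c"
        by (simp add: q12 prepend_nth nth_append)
      moreover have "\<kappa> (length (\<rho> @ q1)) = d"
        using prepend_shift[of "\<rho> @ q1" \<theta> 0] \<theta> by (simp add: \<kappa>_def)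
      ultimately show False
        using d by simp
    qed
    ultimately show "action {w'. w \<sim> w'} ` (boundary_topology v closure_of V) \<subset> V"
      unfolding image by blast
  qed
qed

end

theorem theorem5p16:
  fixes \<Gamma> :: "('v, 'e) pre_digraph" and bar :: "'e \<Rightarrow> 'e"
    and GV :: "'v \<Rightarrow> 'g monoid" and GE :: "'e \<Rightarrow> 'h monoid" and \<alpha> :: "'e \<Rightarrow> 'h \<Rightarrow> 'g"
    and \<Sigma> :: "'e \<Rightarrow> 'g set" and v :: 'v
  assumes "graph_of_groups_transversals \<Gamma> bar GV GE \<alpha> \<Sigma>"
    and "graph_of_groups.locally_finite \<Gamma> GV GE \<alpha>"
    and "graph_of_groups.nonsingular \<Gamma> GV GE \<alpha>"
    and "graph_of_groups.countable_groups \<Gamma> GV"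
    and "arcs \<Gamma> \<noteq> {}"
    and "v \<in> verts \<Gamma>"
    and "\<And>e. e \<in> arcs \<Gamma> \<Longrightarrow>
      \<exists>\<eta>. graph_of_groups_transversals.repeatable \<Gamma> bar GV \<Sigma> \<eta> \<and>
          graph_of_groups_transversals.has_entrance \<Gamma> \<Sigma> \<eta> \<and>
          (\<exists>f \<in> graph_of_groups_transversals.edges \<eta>.
             graph_of_groups_transversals.can_flow_to \<Gamma> bar GV \<Sigma> f e)"
  shows "locally_contractive
    (graph_of_groups_transversals.pi1 \<Gamma> bar GV GE \<alpha> v)
    (graph_of_groups_transversals.boundary_topology \<Gamma> bar GV \<Sigma> v)
    (graph_of_groups_transversals.action \<Gamma> bar GV GE \<alpha> \<Sigma>)"
  using graph_of_groups_transversals.locally_contractive_boundary[OF assms(1,3,7)] .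

end
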